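(* Let $\rho$ be an $N$-qubit density matrix and let $\mathsf K_1,\dots,\mathsf K_L\subseteq\{1,\dots,N\}$ be subsystems with $K=\max_l|\mathsf K_l|$. Fix $\epsilon,\delta\in(0,1)$. Let $\hat\sigma_1,\dots,\hat\sigma_M$ be independent SIC POVM classical shadows of $\rho$ with $$M\ge 6L\,3^K/(\epsilon^2\delta),$$ and for each subsystem $\mathsf K$ define $\hat p_{\mathsf K}=\binom{M}{2}^{-1}\sum_{1\le m<m'\le M}\mathrm{tr}\big(\mathrm{tr}_{\neg\mathsf K}(\hat\sigma_m)\,\mathrm{tr}_{\neg\mathsf K}(\hat\sigma_{m'})\big)$. Then with probability at least $1-\delta$, $$\max_{1\le l\le L}\big|\hat p_{\mathsf K_l}-\mathrm{tr}(\rho_{\mathsf K_l}^2)\big|\le\epsilon,$$ where $\rho_{\mathsf K}=\mathrm{tr}_{\neg\mathsf K}(\rho)$.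
   Context: Let $|\psi_1\rangle,\dots,|\psi_4\rangle\in\mathbb C^2$ be unit vectors forming a single-qubit SIC set, i.e. $|\langle\psi_i|\psi_j\rangle|^2=1/3$ for all $i\neq j$; then $\{\tfrac12|\psi_i\rangle\langle\psi_i|\}_{i=1}^4$ is a POVM. Performing this measurement on each qubit of an $N$-qubit state $\rho$ yields an outcome string $(i_1,\dots,i_N)\in\{1,2,3,4\}^N$ with probability $2^{-N}\langle\psi_{i_1}\otimes\cdots\otimes\psi_{i_N}|\,\rho\,|\psi_{i_1}\otimes\cdots\otimes\psi_{i_N}\rangle$. The SIC POVM classical shadow associated with this outcome is $\hat\sigma=\bigotimes_{n=1}^N\big(3|\psi_{i_n}\rangle\langle\psi_{i_n}|-\mathbb I\big)$; independent shadows arise from measurements on independent copies of $\rho$. $\mathrm{tr}_{\neg\mathsf K}$ is the partial trace over qubits not in $\mathsf K$. *)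

theory Defs
  imports Complex_Main "HOL-Library.FuncSet"
begin

text \<open>Qubits are indexed by 0..N-1. A computational basis string on a set S of qubits
is a function nat => bool that is False outside S. Operators are complex-valued
functions of two basis strings (matrix entries).\<close>

type_synonym qop = "(nat \<Rightarrow> bool) \<Rightarrow> (nat \<Rightarrow> bool) \<Rightarrow> complex"

definition qstr :: "nat set \<Rightarrow> (nat \<Rightarrow> bool) set" where
  "qstr S = {x. \<forall>i. i \<notin> S \<longrightarrow> \<not> x i}"

definition glue :: "nat set \<Rightarrow> (nat \<Rightarrow> bool) \<Rightarrow> (nat \<Rightarrow> bool) \<Rightarrow> (nat \<Rightarrow> bool)" where
  "glue K x z = (\<lambda>i. if i \<in> K then x i else z i)"

definition ptrace :: "nat \<Rightarrow> nat set \<Rightarrow> qop \<Rightarrow> qop" where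
  "ptrace N K A x y = (\<Sum>z\<in>qstr ({..<N} - K). A (glue K x z) (glue K y z))"

definition tr_prod :: "nat set \<Rightarrow> qop \<Rightarrow> qop \<Rightarrow> complex" where
  "tr_prod S A B = (\<Sum>x\<in>qstr S. \<Sum>y\<in>qstr S. A x y * B y x)"

definition density_matrix :: "nat \<Rightarrow> qop \<Rightarrow> bool" where
  "density_matrix N \<rho> \<longleftrightarrow>
     (\<forall>x\<in>qstr {..<N}. \<forall>y\<in>qstr {..<N}. \<rho> y x = cnj (\<rho> x y)) \<and>
     (\<forall>v. 0 \<le> Re (\<Sum>x\<in>qstr {..<N}. \<Sum>y\<in>qstr {..<N}. cnj (v x) * \<rho> x y * v y)) \<and>
     (\<Sum>x\<in>qstr {..<N}. \<rho> x x) = 1"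

definition SIC_set :: "(nat \<Rightarrow> bool \<Rightarrow> complex) \<Rightarrow> bool" where
  "SIC_set \<psi> \<longleftrightarrow>
     (\<forall>i\<in>{1..4}. (\<Sum>b\<in>UNIV. (cmod (\<psi> i b))\<^sup>2) = 1) \<and>
     (\<forall>i\<in>{1..4}. \<forall>j\<in>{1..4}. i \<noteq> j \<longrightarrow>
        (cmod (\<Sum>b\<in>UNIV. cnj (\<psi> i b) * \<psi> j b))\<^sup>2 = 1/3)"

definition outcomes :: "nat \<Rightarrow> (nat \<Rightarrow> nat) set" where
  "outcomes N = {s. (\<forall>n<N. s n \<in> {1..4}) \<and> (\<forall>n. N \<le> n \<longrightarrow> s n = 0)}"

definition prod_state :: "(nat \<Rightarrow> bool \<Rightarrow> complex) \<Rightarrow> nat \<Rightarrow> (nat \<Rightarrow> nat) \<Rightarrow> (nat \<Rightarrow> bool) \<Rightarrow> complex" where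
  "prod_state \<psi> N s x = (\<Prod>n<N. \<psi> (s n) (x n))"

definition outcome_prob :: "(nat \<Rightarrow> bool \<Rightarrow> complex) \<Rightarrow> nat \<Rightarrow> qop \<Rightarrow> (nat \<Rightarrow> nat) \<Rightarrow> real" where
  "outcome_prob \<psi> N \<rho> s = (1 / 2 ^ N) *
     Re (\<Sum>x\<in>qstr {..<N}. \<Sum>y\<in>qstr {..<N}.
            cnj (prod_state \<psi> N s x) * \<rho> x y * prod_state \<psi> N s y)"

text \<open>SIC POVM classical shadow: tensor product of (3|psi_{i_n}><psi_{i_n}| - I).\<close>
definition sic_shadow :: "(nat \<Rightarrow> bool \<Rightarrow> complex) \<Rightarrow> nat \<Rightarrow> (nat \<Rightarrow> nat) \<Rightarrow> qop" where
  "sic_shadow \<psi> N s x y =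
     (\<Prod>n<N. 3 * \<psi> (s n) (x n) * cnj (\<psi> (s n) (y n)) - (if x n = y n then 1 else 0))"

definition purity_estimate :: "nat \<Rightarrow> nat set \<Rightarrow> (nat \<Rightarrow> qop) \<Rightarrow> nat \<Rightarrow> complex" where
  "purity_estimate N K \<sigma> M = (1 / of_nat (M choose 2)) *
     (\<Sum>m<M. \<Sum>m'\<in>{m<..<M}. tr_prod K (ptrace N K (\<sigma> m)) (ptrace N K (\<sigma> m')))"

end

theory Submission
  imports Defs "HOL-Analysis.Cartesian_Space" "HOL-Analysis.Convex"
begin

text \<open>The partial traces of two shadows with outcome strings \<open>s\<close>, \<open>t\<close> have overlap \<open>\<Prod>\<^sub>n h(s\<^sub>n, t\<^sub>n)\<close>
  with \<open>h(i, j) = 5\<close> if \<open>i = j\<close> and \<open>-1\<close> otherwise, so the estimator is a classical U-statistic.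
  A SIC set is a basis of the space of \<open>2 \<times> 2\<close> matrices whose dual basis is read off from its Gram matrix;
  hence \<open>h\<close> represents the swap operator and the mean of the U-statistic is the purity. By Hoeffding's
  decomposition the variance is at most \<open>4 V\<^sub>1 / M + 2 V\<^sub>2 / (M (M - 1))\<close>, with \<open>V\<^sub>2 \<le> 9^K\<close> because
  \<open>h\<^sup>2 = 4 h + 5\<close> and purities of marginals are at most 1, and \<open>V\<^sub>1 \<le> 3^K\<close> because the probability of
  each outcome string on \<open>K\<close> qubits is at most \<open>2^-K\<close> and the matrix square of \<open>h\<close> is at most \<open>6 h\<close> as a quadratic form.
  Chebyshev's inequality and a union bound finish the proof.\<close>

section \<open>U-statistics over a finite distribution\<close>

locale finite_distribution =
  fixes \<Omega> :: "'a set" and p :: "'a \<Rightarrow> real"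
  assumes finite_outcomes: "finite \<Omega>"
    and nonneg: "a \<in> \<Omega> \<Longrightarrow> 0 \<le> p a"
    and total: "sum p \<Omega> = 1"
begin

text \<open>Expectation under the \<open>M\<close>-fold product distribution. Samples are
  extensional functions, so that the probability in the final theorem is a sum over a subset of the
  same index set.\<close>

definition expect :: "nat \<Rightarrow> ((nat \<Rightarrow> 'a) \<Rightarrow> real) \<Rightarrow> real" where
  "expect M f = (\<Sum>S\<in>{..<M} \<rightarrow>\<^sub>E \<Omega>. (\<Prod>m<M. p (S m)) * f S)"

lemma finite_samples: "finite ({..<M} \<rightarrow>\<^sub>E \<Omega>)" for M :: nat
  by (simp add: finite_PiE finite_outcomes)

lemma weight_nonneg: "S \<in> {..<M} \<rightarrow>\<^sub>E \<Omega> \<Longrightarrow> 0 \<le> (\<Prod>m<M. p (S m))" for M :: nat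
  by (intro prod_nonneg) (auto intro: nonneg)

lemma expect_const: "expect M (\<lambda>_. c) = c"
proof -
  have "(\<Sum>S\<in>{..<M} \<rightarrow>\<^sub>E \<Omega>. \<Prod>m<M. p (S m)) = (\<Prod>m<M. \<Sum>a\<in>\<Omega>. p a)"
    by (rule prod_sum_PiE [symmetric]) (auto simp: finite_outcomes)
  then show ?thesis
    by (simp add: expect_def total flip: sum_distrib_right)
qed

lemma expect_add: "expect M (\<lambda>S. f S + g S) = expect M f + expect M g"
  by (simp add: expect_def sum.distrib algebra_simps)

lemma expect_cmult: "expect M (\<lambda>S. c * f S) = c * expect M f"
  by (simp add: expect_def sum_distrib_left algebra_simps)

lemma expect_sum: "expect M (\<lambda>S. \<Sum>j\<in>J. f j S) = (\<Sum>j\<in>J. expect M (f j))"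
  unfolding expect_def sum_distrib_left by (rule sum.swap)

text \<open>Fubini for a single coordinate: by independence, averaging over coordinate
  \<open>m\<close> beforehand leaves the expectation unchanged. Every vanishing cross term below
  rests on it.\<close>

lemma expect_average:
  assumes "m < M"
  shows "expect M f = expect M (\<lambda>S. \<Sum>a\<in>\<Omega>. p a * f (S(m := a)))"
proof -
  define J where "J = {..<M} - {m}"
  have M: "{..<M} = insert m J" "m \<notin> J" "finite J"
    using assms by (auto simp: J_def)
  have split: "expect M f = (\<Sum>g\<in>J \<rightarrow>\<^sub>E \<Omega>. \<Sum>b\<in>\<Omega>. p b * (\<Prod>i\<in>J. p (g i)) * f (g(m := b)))"
    for f :: "(nat \<Rightarrow> 'a) \<Rightarrow> real"
  proof -
    have "expect M f = (\<Sum>(b, g)\<in>\<Omega> \<times> (J \<rightarrow>\<^sub>E \<Omega>). (\<Prod>i\<in>insert m J. p ((g(m := b)) i)) * f (g(m := b)))"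
      unfolding expect_def M(1) PiE_insert_eq
      by (subst sum.reindex [OF inj_combinator [OF M(2)]]) (simp add: case_prod_beta)
    also have "\<dots> = (\<Sum>(b, g)\<in>\<Omega> \<times> (J \<rightarrow>\<^sub>E \<Omega>). p b * (\<Prod>i\<in>J. p (g i)) * f (g(m := b)))"
    proof (rule sum.cong [OF refl], clarify)
      fix b g
      have "(\<Prod>i\<in>J. p ((g(m := b)) i)) = (\<Prod>i\<in>J. p (g i))"
        using M(2) by (intro prod.cong) auto
      then show "(\<Prod>i\<in>insert m J. p ((g(m := b)) i)) * f (g(m := b)) = p b * (\<Prod>i\<in>J. p (g i)) * f (g(m := b))"
        using M by simp
    qed
    finally show ?thesis
      by (simp add: sum.cartesian_product [symmetric] sum.swap [of _ _ \<Omega>])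
  qed
  \<comment> \<open>The inner average overwrites coordinate \<open>m\<close>, so it does not depend
    on \<open>b\<close>, and the weights of \<open>b\<close> sum to 1.\<close>
  have "(\<Sum>b\<in>\<Omega>. p b * (\<Prod>i\<in>J. p (g i)) * (\<Sum>a\<in>\<Omega>. p a * f (g(m := b, m := a))))
      = (\<Sum>b\<in>\<Omega>. p b * (\<Prod>i\<in>J. p (g i)) * f (g(m := b)))" for g
  proof -
    have "(\<Sum>b\<in>\<Omega>. p b * (\<Prod>i\<in>J. p (g i)) * (\<Sum>a\<in>\<Omega>. p a * f (g(m := b, m := a))))
      = sum p \<Omega> * ((\<Prod>i\<in>J. p (g i)) * (\<Sum>a\<in>\<Omega>. p a * f (g(m := a))))"
      unfolding sum_distrib_right by (simp add: mult.assoc)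
    then show ?thesis
      by (simp add: total sum_distrib_left mult_ac)
  qed
  then show ?thesis
    unfolding split [of f] split [of "\<lambda>S. \<Sum>a\<in>\<Omega>. p a * f (S(m := a))"] by simp
qed

lemma expect_eq_0:
  assumes "m < M" and "\<And>S. (\<Sum>a\<in>\<Omega>. p a * f (S(m := a))) = 0"
  shows "expect M f = 0"
  by (subst expect_average [OF assms(1)]) (simp add: assms(2) expect_const)

lemma expect_one_coordinate:
  assumes "m < M"
  shows "expect M (\<lambda>S. f (S m)) = (\<Sum>a\<in>\<Omega>. p a * f a)"
  by (subst expect_average [OF assms]) (simp add: expect_const)

lemma expect_two_coordinates:
  assumes "m < M" "k < M" "m \<noteq> k"
  shows "expect M (\<lambda>S. f (S m) (S k)) = (\<Sum>a\<in>\<Omega>. \<Sum>b\<in>\<Omega>. p a * p b * f a b)"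
proof -
  have "expect M (\<lambda>S. f (S m) (S k)) = expect M (\<lambda>S. \<Sum>a\<in>\<Omega>. p a * f a (S k))"
    using assms by (subst expect_average [OF assms(1)]) simp
  also have "\<dots> = (\<Sum>b\<in>\<Omega>. p b * (\<Sum>a\<in>\<Omega>. p a * f a b))"
    by (rule expect_one_coordinate [OF assms(2)])
  also have "\<dots> = (\<Sum>a\<in>\<Omega>. \<Sum>b\<in>\<Omega>. p a * p b * f a b)"
    by (subst sum.swap) (simp add: sum_distrib_left mult_ac)
  finally show ?thesis .
qed

lemma expect_square_orthogonal_sum:
  assumes "finite J" and "\<And>i j. i \<in> J \<Longrightarrow> j \<in> J \<Longrightarrow> i \<noteq> j \<Longrightarrow> expect M (\<lambda>S. X i S * X j S) = 0"
  shows "expect M (\<lambda>S. (\<Sum>j\<in>J. X j S)\<^sup>2) = (\<Sum>j\<in>J. expect M (\<lambda>S. (X j S)\<^sup>2))"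
proof -
  have "expect M (\<lambda>S. (\<Sum>j\<in>J. X j S)\<^sup>2) = (\<Sum>i\<in>J. \<Sum>j\<in>J. expect M (\<lambda>S. X i S * X j S))"
    by (simp add: power2_eq_square sum_product expect_sum)
  also have "\<dots> = (\<Sum>i\<in>J. \<Sum>j\<in>J. if j = i then expect M (\<lambda>S. (X i S)\<^sup>2) else 0)"
    by (intro sum.cong refl) (auto simp: assms(2) power2_eq_square)
  finally show ?thesis
    using assms(1) by simp
qed

text \<open>Chebyshev's inequality and the union bound come from one pointwise estimate: outside the
  good event the sum of all squares divided by \<open>\<epsilon>\<^sup>2\<close> is already at least
  1.\<close>

lemma chebyshev_union:
  assumes "finite J" "0 < \<epsilon>" "\<And>j. j \<in> J \<Longrightarrow> expect M (\<lambda>S. (Z j S)\<^sup>2) \<le> v"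
  shows "1 - real (card J) * v / \<epsilon>\<^sup>2
    \<le> (\<Sum>S\<in>{S \<in> {..<M} \<rightarrow>\<^sub>E \<Omega>. \<forall>j\<in>J. \<bar>Z j S\<bar> \<le> \<epsilon>}. \<Prod>m<M. p (S m))"
proof -
  let ?w = "\<lambda>S. \<Prod>m<M. p (S m)"
  let ?good = "\<lambda>S. \<forall>j\<in>J. \<bar>Z j S\<bar> \<le> \<epsilon>"
  have pointwise: "?w S \<le> (if ?good S then ?w S else 0) + (?w S * (\<Sum>j\<in>J. (Z j S)\<^sup>2)) / \<epsilon>\<^sup>2"
    if S: "S \<in> {..<M} \<rightarrow>\<^sub>E \<Omega>" for S
  proof (cases "?good S")
    case True
    then show ?thesis
      using weight_nonneg [OF S] by (simp add: sum_nonneg)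
  next
    case False
    then obtain j where j: "j \<in> J" "\<epsilon> < \<bar>Z j S\<bar>"
      by force
    have "\<epsilon>\<^sup>2 \<le> (Z j S)\<^sup>2"
      using j(2) assms(2) by (simp add: abs_le_square_iff [symmetric])
    also have "\<dots> \<le> (\<Sum>j\<in>J. (Z j S)\<^sup>2)"
      using j(1) assms(1) by (intro member_le_sum) auto
    finally have "?w S * \<epsilon>\<^sup>2 \<le> ?w S * (\<Sum>j\<in>J. (Z j S)\<^sup>2)"
      using weight_nonneg [OF S] by (rule mult_left_mono)
    then have "?w S \<le> (?w S * (\<Sum>j\<in>J. (Z j S)\<^sup>2)) / \<epsilon>\<^sup>2"
      using assms(2) by (simp add: pos_le_divide_eq)
    then show ?thesis
      by (simp only: False if_False add_0)
  qed
  have "1 = (\<Sum>S\<in>{..<M} \<rightarrow>\<^sub>E \<Omega>. ?w S)"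
    using expect_const [of M 1] by (simp add: expect_def)
  also have "\<dots> \<le> (\<Sum>S\<in>{..<M} \<rightarrow>\<^sub>E \<Omega>. (if ?good S then ?w S else 0) + (?w S * (\<Sum>j\<in>J. (Z j S)\<^sup>2)) / \<epsilon>\<^sup>2)"
    by (intro sum_mono pointwise)
  also have "\<dots> = (\<Sum>S\<in>{S \<in> {..<M} \<rightarrow>\<^sub>E \<Omega>. ?good S}. ?w S) + (\<Sum>j\<in>J. expect M (\<lambda>S. (Z j S)\<^sup>2)) / \<epsilon>\<^sup>2"
    using expect_sum [of M "\<lambda>j S. (Z j S)\<^sup>2" J]
    by (simp add: sum.distrib sum.inter_filter finite_samples expect_def flip: sum_divide_distrib)
  also have "(\<Sum>j\<in>J. expect M (\<lambda>S. (Z j S)\<^sup>2)) / \<epsilon>\<^sup>2 \<le> real (card J) * v / \<epsilon>\<^sup>2"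
    by (intro divide_right_mono sum_bounded_above assms(3)) auto
  finally show ?thesis
    by simp
qed

end

section \<open>Pairs of indices and Hoeffding's decomposition\<close>

lemma sum_pairs_add:
  fixes y :: "nat \<Rightarrow> real"
  shows "(\<Sum>m<M. \<Sum>k\<in>{m<..<M}. y m + y k) = (real M - 1) * (\<Sum>m<M. y m)"
proof (induction M)
  case (Suc M)
  have "(\<Sum>m<Suc M. \<Sum>k\<in>{m<..<Suc M}. y m + y k)
      = (\<Sum>m<M. (\<Sum>k\<in>{m<..<M}. y m + y k) + (y m + y M))"
  proof -
    have "{m<..<Suc M} = insert M {m<..<M}" if "m < M" for m
      using that by auto
    moreover have "{M<..<Suc M} = {}"
      by auto
    ultimately show ?thesis
      by (simp add: add.commute)
  qed
  also have "\<dots> = (real M - 1) * (\<Sum>m<M. y m) + (\<Sum>m<M. y m) + real M * y M"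
    by (subst sum.distrib, subst Suc.IH) (simp add: sum.distrib)
  finally show ?case
    by (simp add: algebra_simps)
qed simp

lemma choose_two_real: "real (M choose 2) = real M * (real M - 1) / 2"
proof (cases M)
  case (Suc n)
  have "even (Suc n * n)"
    by simp
  then show ?thesis
    using Suc by (simp add: choose_two real_of_nat_div algebra_simps)
qed simp

locale symmetric_kernel = finite_distribution +
  fixes h :: "'a \<Rightarrow> 'a \<Rightarrow> real"
  assumes sym: "h a b = h b a"
begin

definition mean :: real where
  "mean = (\<Sum>a\<in>\<Omega>. \<Sum>b\<in>\<Omega>. p a * p b * h a b)"

text \<open>The conditional mean of the kernel given one argument, which is its first-order
  Hoeffding projection.\<close>

definition proj :: "'a \<Rightarrow> real" where
  "proj a = (\<Sum>b\<in>\<Omega>. p b * h a b)"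

text \<open>The second-order Hoeffding component, built so that its average over either argument
  vanishes.\<close>

definition degen :: "'a \<Rightarrow> 'a \<Rightarrow> real" where
  "degen a b = h a b - proj a - proj b + mean"

lemma average_const: "(\<Sum>a\<in>\<Omega>. p a * c) = c"
  by (simp add: total flip: sum_distrib_right)

lemma average_proj: "(\<Sum>a\<in>\<Omega>. p a * proj a) = mean"
  by (simp add: mean_def proj_def sum_distrib_left mult_ac)

lemma average_proj_diff: "(\<Sum>a\<in>\<Omega>. p a * (proj a - mean)) = 0"
  by (simp add: right_diff_distrib sum_subtractf average_proj average_const)

lemma average_degen: "(\<Sum>a\<in>\<Omega>. p a * degen a b) = 0" "(\<Sum>a\<in>\<Omega>. p a * degen b a) = 0"
proof -
  have "degen a b = degen b a" for a
    by (simp add: degen_def sym)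
  moreover have "(\<Sum>a\<in>\<Omega>. p a * degen b a) = 0"
    by (simp add: degen_def distrib_left right_diff_distrib sum.distrib sum_subtractf
        average_proj average_const) (simp add: proj_def)
  ultimately show "(\<Sum>a\<in>\<Omega>. p a * degen a b) = 0" "(\<Sum>a\<in>\<Omega>. p a * degen b a) = 0"
    by simp_all
qed

lemma average_degen_mult:
  "(\<Sum>a\<in>\<Omega>. p a * (degen a b * c)) = 0" "(\<Sum>a\<in>\<Omega>. p a * (degen b a * c)) = 0"
  "(\<Sum>a\<in>\<Omega>. p a * (c * degen a b)) = 0" "(\<Sum>a\<in>\<Omega>. p a * (c * degen b a)) = 0"
proof -
  have "p a * (degen x y * c) = c * (p a * degen x y)" "p a * (c * degen x y) = c * (p a * degen x y)" for a x y
    by simp_all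
  then show "(\<Sum>a\<in>\<Omega>. p a * (degen a b * c)) = 0" "(\<Sum>a\<in>\<Omega>. p a * (degen b a * c)) = 0"
    "(\<Sum>a\<in>\<Omega>. p a * (c * degen a b)) = 0" "(\<Sum>a\<in>\<Omega>. p a * (c * degen b a)) = 0"
    by (simp_all only: sum_distrib_left [symmetric] average_degen mult_zero_right)
qed

lemma average_square_proj:
  "(\<Sum>a\<in>\<Omega>. p a * (proj a - mean)\<^sup>2) \<le> (\<Sum>a\<in>\<Omega>. p a * (proj a)\<^sup>2)"
proof -
  have "(\<Sum>a\<in>\<Omega>. p a * (proj a - mean)\<^sup>2)
      = (\<Sum>a\<in>\<Omega>. p a * (proj a)\<^sup>2 - 2 * mean * (p a * proj a) + p a * mean\<^sup>2)"
    by (simp add: power2_diff algebra_simps)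
  also have "\<dots> = (\<Sum>a\<in>\<Omega>. p a * (proj a)\<^sup>2) - mean\<^sup>2"
    by (simp add: sum.distrib sum_subtractf average_proj average_const flip: sum_distrib_left)
      (simp add: power2_eq_square)
  finally show ?thesis
    by simp
qed

text \<open>\<open>degen\<close> is orthogonal to functions of one argument alone, so Pythagoras
  bounds its norm by that of \<open>h\<close>.\<close>

lemma average_square_degen:
  "(\<Sum>a\<in>\<Omega>. \<Sum>b\<in>\<Omega>. p a * p b * (degen a b)\<^sup>2) \<le> (\<Sum>a\<in>\<Omega>. \<Sum>b\<in>\<Omega>. p a * p b * (h a b)\<^sup>2)"
proof -
  let ?r = "\<lambda>a b. proj a + proj b - mean"
  \<comment> \<open>The cross term is cut in two: the piece with \<open>proj a\<close> vanishes on
    averaging over \<open>b\<close>, the piece with \<open>proj b - mean\<close> on averaging over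
    \<open>a\<close>.\<close>
  have eq: "p a * p b * (h a b)\<^sup>2 = p a * p b * (degen a b)\<^sup>2 + p a * p b * (?r a b)\<^sup>2
      + 2 * (p b * (p a * (proj a * degen a b))) + 2 * (p a * (p b * (degen a b * (proj b - mean))))" for a b
  proof -
    have h: "h a b = degen a b + ?r a b"
      by (simp add: degen_def)
    show ?thesis
      unfolding h by (simp add: power2_eq_square algebra_simps)
  qed
  have "(\<Sum>a\<in>\<Omega>. \<Sum>b\<in>\<Omega>. p b * (p a * (proj a * degen a b))) = 0"
    by (simp add: mult.left_commute [of "p _" "p _"] average_degen_mult flip: sum_distrib_left)
  moreover have "(\<Sum>a\<in>\<Omega>. \<Sum>b\<in>\<Omega>. p a * (p b * (degen a b * (proj b - mean)))) = 0"
    by (subst sum.swap) (simp add: mult.left_commute [of "p _" "p _"] average_degen_mult flip: sum_distrib_left)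
  ultimately have "(\<Sum>a\<in>\<Omega>. \<Sum>b\<in>\<Omega>. p a * p b * (h a b)\<^sup>2)
    = (\<Sum>a\<in>\<Omega>. \<Sum>b\<in>\<Omega>. p a * p b * (degen a b)\<^sup>2) + (\<Sum>a\<in>\<Omega>. \<Sum>b\<in>\<Omega>. p a * p b * (?r a b)\<^sup>2)"
    unfolding eq sum.distrib sum_distrib_left [symmetric] by simp
  moreover have "0 \<le> (\<Sum>a\<in>\<Omega>. \<Sum>b\<in>\<Omega>. p a * p b * (?r a b)\<^sup>2)"
    by (intro sum_nonneg mult_nonneg_nonneg) (auto intro: nonneg)
  ultimately show ?thesis
    by simp
qed

definition ustat :: "nat \<Rightarrow> (nat \<Rightarrow> 'a) \<Rightarrow> real" where
  "ustat M S = (\<Sum>m<M. \<Sum>k\<in>{m<..<M}. h (S m) (S k)) / real (M choose 2)"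

text \<open>Each sample occurs in \<open>M - 1\<close> of the \<open>M * (M - 1) / 2\<close> pairs,
  whence the coefficient \<open>2 / M\<close> of the linear part.\<close>

lemma ustat_decomposition:
  assumes "2 \<le> M"
  shows "ustat M S - mean = 2 / real M * (\<Sum>m<M. proj (S m) - mean)
    + (\<Sum>(m, k)\<in>Sigma {..<M} (\<lambda>m. {m<..<M}). degen (S m) (S k)) / real (M choose 2)"
proof -
  let ?C = "real (M choose 2)"
  have C: "?C = real M * (real M - 1) / 2" "?C > 0"
    using assms by (auto simp: choose_two_real)
  define y where "y m = proj (S m) - mean" for m
  \<comment> \<open>Halving \<open>mean\<close> gives the constant the form
    \<open>y m + y k\<close>, so that \<open>sum_pairs_add\<close> evaluates it as well.\<close>
  have "(\<Sum>m<M. \<Sum>k\<in>{m<..<M}. h (S m) (S k))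
      = (\<Sum>m<M. \<Sum>k\<in>{m<..<M}. y m + y k + degen (S m) (S k) + (mean / 2 + mean / 2))"
    by (simp add: degen_def y_def)
  also have "\<dots> = (\<Sum>m<M. \<Sum>k\<in>{m<..<M}. y m + y k) + (\<Sum>m<M. \<Sum>k\<in>{m<..<M}. degen (S m) (S k))
      + (\<Sum>m<M. \<Sum>k\<in>{m<..<M}. mean / 2 + mean / 2)"
    by (simp only: sum.distrib ac_simps)
  also have "\<dots> = (real M - 1) * (\<Sum>m<M. y m)
      + (\<Sum>(m, k)\<in>Sigma {..<M} (\<lambda>m. {m<..<M}). degen (S m) (S k)) + ?C * mean"
    by (simp only: sum_pairs_add C(1)) (simp add: sum.Sigma)
  finally show ?thesis
    using C(2) assms unfolding ustat_def y_def by (simp add: add_divide_distrib) (simp add: C(1) field_simps)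
qed

text \<open>All summands of Hoeffding's decomposition are pairwise uncorrelated, so only diagonal
  terms remain: \<open>M\<close> of them scaled by \<open>(2 / M)\<^sup>2\<close>, and one for each
  pair scaled by the inverse square of the number of pairs.\<close>

lemma expect_square_ustat:
  assumes "2 \<le> M"
  shows "expect M (\<lambda>S. (ustat M S - mean)\<^sup>2)
    \<le> 4 / real M * (\<Sum>a\<in>\<Omega>. p a * (proj a)\<^sup>2)
      + 2 / (real M * (real M - 1)) * (\<Sum>a\<in>\<Omega>. \<Sum>b\<in>\<Omega>. p a * p b * (h a b)\<^sup>2)"
proof -
  let ?C = "real (M choose 2)"
  let ?P = "Sigma {..<M} (\<lambda>m. {m<..<M})"
  let ?Y = "\<lambda>m S. proj (S m) - mean"
  let ?g = "\<lambda>q S. degen (S (fst q)) (S (snd q))"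
  have C: "?C = real M * (real M - 1) / 2" "?C > 0"
    using assms by (auto simp: choose_two_real)
  have YY: "expect M (\<lambda>S. ?Y m S * ?Y k S) = 0" if "m < M" "k < M" "m \<noteq> k" for m k
    using that average_proj_diff
    by (intro expect_eq_0 [of m]) (auto simp: mult.assoc [symmetric] simp flip: sum_distrib_right)
  \<comment> \<open>One member of the pair \<open>q\<close> differs from \<open>m\<close>; averaging
    over it annihilates \<open>degen\<close> and leaves the other factor fixed.\<close>
  have Yg: "expect M (\<lambda>S. ?Y m S * ?g q S) = 0" if "m < M" "q \<in> ?P" for m q
  proof (cases "fst q = m")
    case True
    then show ?thesis
      using that by (intro expect_eq_0 [of "snd q"]) (auto simp: average_degen_mult)
  next
    case False
    then show ?thesis
      using that by (intro expect_eq_0 [of "fst q"]) (auto simp: average_degen_mult)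
  qed
  \<comment> \<open>Pairs are increasing, so of two distinct pairs the first has a member outside
    the second: if \<open>fst q\<close> lies in \<open>r\<close>, then \<open>snd q\<close> does
    not.\<close>
  have gg: "expect M (\<lambda>S. ?g q S * ?g r S) = 0" if "q \<in> ?P" "r \<in> ?P" "q \<noteq> r" for q r
  proof (cases "fst q = fst r \<or> fst q = snd r")
    case True
    then have "snd q \<noteq> fst r \<and> snd q \<noteq> snd r"
      using that by (auto simp: prod_eq_iff)
    then show ?thesis
      using that by (intro expect_eq_0 [of "snd q"]) (auto simp: average_degen_mult)
  next
    case False
    then show ?thesis
      using that by (intro expect_eq_0 [of "fst q"]) (auto simp: average_degen_mult)
  qed
  have Y2: "expect M (\<lambda>S. (\<Sum>m<M. ?Y m S)\<^sup>2) \<le> real M * (\<Sum>a\<in>\<Omega>. p a * (proj a)\<^sup>2)"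
  proof -
    have "expect M (\<lambda>S. (\<Sum>m<M. ?Y m S)\<^sup>2) = (\<Sum>m<M. expect M (\<lambda>S. (?Y m S)\<^sup>2))"
      by (rule expect_square_orthogonal_sum) (auto simp: YY)
    also have "\<dots> = real M * (\<Sum>a\<in>\<Omega>. p a * (proj a - mean)\<^sup>2)"
      by (simp add: expect_one_coordinate [where f = "\<lambda>a. (proj a - mean)\<^sup>2"])
    finally show ?thesis
      using average_square_proj by (simp add: mult_left_mono)
  qed
  have g2: "expect M (\<lambda>S. (\<Sum>q\<in>?P. ?g q S)\<^sup>2) \<le> ?C * (\<Sum>a\<in>\<Omega>. \<Sum>b\<in>\<Omega>. p a * p b * (h a b)\<^sup>2)"
  proof -
    \<comment> \<open>With the constant 1/2 each pair contributes 1, so \<open>sum_pairs_add\<close>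
      counts the pairs.\<close>
    have card: "real (card ?P) = ?C"
      using sum_pairs_add [of "\<lambda>_. 1/2" M] C by (simp add: mult.commute)
    have "expect M (\<lambda>S. (\<Sum>q\<in>?P. ?g q S)\<^sup>2) = (\<Sum>q\<in>?P. expect M (\<lambda>S. (?g q S)\<^sup>2))"
      by (rule expect_square_orthogonal_sum) (auto simp: gg)
    also have "\<dots> = (\<Sum>q\<in>?P. \<Sum>a\<in>\<Omega>. \<Sum>b\<in>\<Omega>. p a * p b * (degen a b)\<^sup>2)"
      by (intro sum.cong refl expect_two_coordinates [where f = "\<lambda>a b. (degen a b)\<^sup>2"]) auto
    finally show ?thesis
      using average_square_degen card by (simp add: mult_left_mono)
  qed
  let ?A = "\<lambda>S. \<Sum>m<M. ?Y m S" and ?B = "\<lambda>S. \<Sum>q\<in>?P. ?g q S"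
  have AB: "expect M (\<lambda>S. ?A S * ?B S) = 0"
    by (simp add: sum_product expect_sum Yg)
  have "expect M (\<lambda>S. (ustat M S - mean)\<^sup>2)
    = expect M (\<lambda>S. (2 / M)\<^sup>2 * (?A S)\<^sup>2 + ((4 / (M * ?C)) * (?A S * ?B S) + (1 / ?C)\<^sup>2 * (?B S)\<^sup>2))"
    unfolding ustat_decomposition [OF assms] case_prod_beta
    by (simp add: power2_sum power_mult_distrib power_divide add_ac mult.assoc)
  also have "\<dots> = (2 / M)\<^sup>2 * expect M (\<lambda>S. (?A S)\<^sup>2) + (1 / ?C)\<^sup>2 * expect M (\<lambda>S. (?B S)\<^sup>2)"
    by (simp only: expect_add expect_cmult AB mult_zero_right add_0)
  also have "\<dots> \<le> (2 / M)\<^sup>2 * (real M * (\<Sum>a\<in>\<Omega>. p a * (proj a)\<^sup>2))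
      + (1 / ?C)\<^sup>2 * (?C * (\<Sum>a\<in>\<Omega>. \<Sum>b\<in>\<Omega>. p a * p b * (h a b)\<^sup>2))"
    by (intro add_mono mult_left_mono Y2 g2) auto
  also have "\<dots> = 4 / real M * (\<Sum>a\<in>\<Omega>. p a * (proj a)\<^sup>2)
      + 1 / ?C * (\<Sum>a\<in>\<Omega>. \<Sum>b\<in>\<Omega>. p a * p b * (h a b)\<^sup>2)"
    using assms C(2) by (simp add: power2_eq_square)
  finally show ?thesis
    by (simp add: C(1))
qed

end

section \<open>Operators on qubits and single-qubit SIC identities\<close>

text \<open>Distributivity over total functions that take a default value outside \<open>I\<close>;
  basis strings (default \<open>False\<close>) and outcome strings (default 0) are both of this
  kind.\<close>

lemma sum_prod_default:
  fixes g :: "'i \<Rightarrow> 'b \<Rightarrow> 'c::comm_semiring_1"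
  assumes "finite I" "finite T"
  shows "(\<Sum>f\<in>{f. (\<forall>n\<in>I. f n \<in> T) \<and> (\<forall>n. n \<notin> I \<longrightarrow> f n = d)}. \<Prod>n\<in>I. g n (f n))
    = (\<Prod>n\<in>I. \<Sum>b\<in>T. g n b)"
proof -
  have "(\<Sum>f\<in>{f. (\<forall>n\<in>I. f n \<in> T) \<and> (\<forall>n. n \<notin> I \<longrightarrow> f n = d)}. \<Prod>n\<in>I. g n (f n))
    = (\<Sum>f\<in>I \<rightarrow>\<^sub>E T. \<Prod>n\<in>I. g n (f n))"
    by (rule sum.reindex_bij_witness [where i = "\<lambda>f n. if n \<in> I then f n else d" and j = "\<lambda>f. restrict f I"])
      (auto simp: fun_eq_iff PiE_def extensional_def restrict_def)
  then show ?thesis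
    by (simp add: prod_sum_PiE assms)
qed

lemma finite_default_functions:
  assumes "finite I" "finite T"
  shows "finite {f. (\<forall>n\<in>I. f n \<in> T) \<and> (\<forall>n. n \<notin> I \<longrightarrow> f n = d)}"
  using finite_set_of_finite_funs [OF assms, of d]
  by (rule rev_finite_subset) auto

lemma qstr_default: "qstr I = {f. (\<forall>n\<in>I. f n \<in> UNIV) \<and> (\<forall>n. n \<notin> I \<longrightarrow> f n = False)}"
  by (auto simp: qstr_def)

lemma finite_qstr: "finite I \<Longrightarrow> finite (qstr I)"
  unfolding qstr_default by (rule finite_default_functions) auto

lemma sum_qstr_prod:
  fixes g :: "nat \<Rightarrow> bool \<Rightarrow> 'c::comm_semiring_1"
  assumes "finite I"
  shows "(\<Sum>x\<in>qstr I. \<Prod>n\<in>I. g n (x n)) = (\<Prod>n\<in>I. \<Sum>b\<in>UNIV. g n b)"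
  unfolding qstr_default by (rule sum_prod_default) (auto simp: assms)

definition outcomes_on :: "nat set \<Rightarrow> (nat \<Rightarrow> nat) set" where
  "outcomes_on K = {t. (\<forall>n\<in>K. t n \<in> {1..4}) \<and> (\<forall>n. n \<notin> K \<longrightarrow> t n = 0)}"

lemma outcomes_eq: "outcomes N = outcomes_on {..<N}"
  by (auto simp: outcomes_def outcomes_on_def)

lemma finite_outcomes_on: "finite K \<Longrightarrow> finite (outcomes_on K)"
  unfolding outcomes_on_def by (rule finite_default_functions) auto

lemma sum_outcomes_prod:
  fixes g :: "nat \<Rightarrow> nat \<Rightarrow> 'c::comm_semiring_1"
  assumes "finite K"
  shows "(\<Sum>t\<in>outcomes_on K. \<Prod>n\<in>K. g n (t n)) = (\<Prod>n\<in>K. \<Sum>i\<in>{1..4}. g n i)"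
  unfolding outcomes_on_def by (rule sum_prod_default) (auto simp: assms)

lemma sum_qstr_glue:
  assumes "K \<subseteq> {..<N}"
  shows "(\<Sum>x\<in>qstr {..<N}. F x) = (\<Sum>a\<in>qstr K. \<Sum>z\<in>qstr ({..<N} - K). F (glue K a z))"
proof -
  have "(\<Sum>x\<in>qstr {..<N}. F x) = (\<Sum>(a, z)\<in>qstr K \<times> qstr ({..<N} - K). F (glue K a z))"
    by (rule sum.reindex_bij_witness [where i = "\<lambda>(a, z). glue K a z"
          and j = "\<lambda>x. (\<lambda>n. n \<in> K \<and> x n, \<lambda>n. n \<notin> K \<and> x n)"])
      (use assms in \<open>auto simp: glue_def qstr_def fun_eq_iff\<close>)
  then show ?thesis
    by (simp add: sum.cartesian_product)
qed

text \<open>With P_i the projector onto \<open>\<psi> i\<close>, this is tr((3 P_i - I)(3 P_j - I))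
  = 9 tr(P_i P_j) - 3 - 3 + 2, that is 9 - 4 for equal and 3 - 4 for distinct indices.\<close>

definition sic_kernel :: "nat \<Rightarrow> nat \<Rightarrow> real" where
  "sic_kernel i j = (if i = j then 5 else -1)"

section \<open>Single-qubit identities for a SIC set\<close>

lemma sum_1_4: "(\<Sum>i\<in>{1..4::nat}. f i) = f 1 + f 2 + f 3 + f 4" for f :: "nat \<Rightarrow> 'a::comm_monoid_add"
  by (simp add: numeral_eq_Suc atLeastAtMostSuc_conv add_ac)

lemma in_1_4: "i \<in> {1..4::nat} \<longleftrightarrow> i = 1 \<or> i = 2 \<or> i = 3 \<or> i = 4"
  by auto

lemma SIC_norm:
  assumes "SIC_set \<psi>" "i \<in> {1..4}"
  shows "(\<Sum>b\<in>UNIV. \<psi> i b * cnj (\<psi> i b)) = 1"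
proof -
  have "(\<Sum>b\<in>UNIV. \<psi> i b * cnj (\<psi> i b)) = of_real (\<Sum>b\<in>UNIV. (cmod (\<psi> i b))\<^sup>2)"
    by (simp only: of_real_sum complex_norm_square)
  also have "(\<Sum>b\<in>UNIV. (cmod (\<psi> i b))\<^sup>2) = 1"
    using assms unfolding SIC_set_def by blast
  finally show ?thesis
    by simp
qed

lemma SIC_trace:
  assumes "SIC_set \<psi>" "i \<in> {1..4}" "j \<in> {1..4}"
  shows "(\<Sum>a\<in>UNIV. \<Sum>b\<in>UNIV. (\<psi> i a * cnj (\<psi> i b)) * (\<psi> j b * cnj (\<psi> j a))) = (if i = j then 1 else 1/3)"
proof -
  have "(\<Sum>a\<in>UNIV. \<Sum>b\<in>UNIV. (\<psi> i a * cnj (\<psi> i b)) * (\<psi> j b * cnj (\<psi> j a)))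
    = (\<Sum>b\<in>UNIV. cnj (\<psi> i b) * \<psi> j b) * cnj (\<Sum>b\<in>UNIV. cnj (\<psi> i b) * \<psi> j b)"
    by (simp add: UNIV_bool algebra_simps)
  also have "\<dots> = of_real ((cmod (\<Sum>b\<in>UNIV. cnj (\<psi> i b) * \<psi> j b))\<^sup>2)"
    by (simp only: complex_norm_square)
  also have "\<dots> = (if i = j then 1 else 1/3)"
  proof (cases "i = j")
    case True
    then have "(\<Sum>b\<in>UNIV. cnj (\<psi> i b) * \<psi> j b) = 1"
      using SIC_norm [OF assms(1,2)] by (simp add: mult.commute)
    then show ?thesis
      using True by simp
  next
    case False
    then have "(cmod (\<Sum>b\<in>UNIV. cnj (\<psi> i b) * \<psi> j b))\<^sup>2 = 1/3"
      using assms unfolding SIC_set_def by blast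
    then show ?thesis
      by (simp only: False if_False) simp
  qed
  finally show ?thesis .
qed

text \<open>The sum of \<open>sic_kernel i j\<close> times the tensor product of P_i and P_j is four
  times the swap operator. The Gram matrix of the projectors is (2/3) I + (1/3) J, with J the
  all-ones matrix. Its inverse is a quarter of \<open>sic_kernel\<close>, which is 6 I - J. This
  gives the dual family explicitly, and in dimension four biorthogonality already implies
  completeness.\<close>

lemma SIC_frame:
  assumes "SIC_set \<psi>"
  shows "(\<Sum>i\<in>{1..4}. \<Sum>j\<in>{1..4}. of_real (sic_kernel i j) * (cnj (\<psi> i a) * \<psi> i b) * (cnj (\<psi> j c) * \<psi> j d))
    = (if a = d \<and> b = c then 4 else 0)"
proof -
  \<comment> \<open>An enumeration of the four labels by pairs of bits, so that projectors and
    matrix entries share one finite index type and the matrices below are square.\<close>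
  define e :: "bool \<times> bool \<Rightarrow> nat" where "e p = 1 + of_bool (fst p) + 2 * of_bool (snd p)" for p
  have UNIV: "(UNIV :: (bool \<times> bool) set) = {(False, False), (False, True), (True, False), (True, True)}"
    by auto
  have e: "bij_betw e UNIV {1..4}"
    by (rule bij_betwI [where g = "\<lambda>i. (i = 2 \<or> i = 4, i = 3 \<or> i = 4)"]) (auto simp: e_def)
  define P where "P i p = \<psi> i (fst p) * cnj (\<psi> i (snd p))" for i and p :: "bool \<times> bool"
  \<comment> \<open>The rows of \<open>B\<close> are the projectors, the columns of \<open>C\<close>
    their duals.\<close>
  define B :: "complex^(bool \<times> bool)^(bool \<times> bool)" where "B = (\<chi> k p. P (e k) p)"
  define C :: "complex^(bool \<times> bool)^(bool \<times> bool)" where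
    "C = (\<chi> p k. \<Sum>j\<in>{1..4}. cnj (P j p) * of_real (sic_kernel j (e k)) / 4)"
  have orth: "(\<Sum>p\<in>UNIV. P i p * cnj (P j p)) = (if i = j then 1 else 1/3)"
    if "i \<in> {1..4}" "j \<in> {1..4}" for i j
    using SIC_trace [OF assms that] by (simp add: UNIV UNIV_bool P_def algebra_simps)
  have dual: "(\<Sum>p\<in>UNIV. P i p * (\<Sum>j\<in>{1..4}. cnj (P j p) * of_real (sic_kernel j k) / 4)) = (if i = k then 1 else 0)"
    if "i \<in> {1..4}" "k \<in> {1..4}" for i k
  proof -
    have "(\<Sum>p\<in>UNIV. P i p * (\<Sum>j\<in>{1..4}. cnj (P j p) * of_real (sic_kernel j k) / 4))
      = (\<Sum>j\<in>{1..4}. (\<Sum>p\<in>UNIV. P i p * cnj (P j p)) * of_real (sic_kernel j k) / 4)"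
      by (simp add: sum_distrib_left sum_distrib_right sum_divide_distrib mult.assoc) (rule sum.swap)
    also have "\<dots> = (\<Sum>j\<in>{1..4}. (if i = j then 1 else 1/3) * of_real (sic_kernel j k) / 4)"
      by (intro sum.cong refl) (simp only: orth [OF that(1)])
    also have "\<dots> = (if i = k then 1 else 0)"
      using that unfolding sum_1_4 in_1_4 by (auto simp: sic_kernel_def)
    finally show ?thesis .
  qed
  have einj: "e k = e l \<longleftrightarrow> k = l" for k l
    using bij_betw_imp_inj_on [OF e] by (auto dest: injD)
  have ein: "e k \<in> {1..4}" for k
    using e by (auto simp: bij_betw_def)
  have "B ** C = mat 1"
    by (simp only: vec_eq_iff matrix_matrix_mult_def mat_def B_def C_def vec_lambda_beta dual [OF ein ein] einj) simp
  \<comment> \<open>A right inverse of a square matrix is a left inverse: biorthogonality becomes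
    completeness.\<close>
  then have "C ** B = mat 1"
    by (simp add: matrix_left_right_inverse)
  \<comment> \<open>The second index pair is reversed because \<open>P i (d, c)\<close> is
    \<open>\<psi> i d * cnj (\<psi> i c)\<close>, the conjugation pattern of the claim.\<close>
  then have "(C ** B) $ (a, b) $ (d, c) = (mat 1 :: complex^(bool \<times> bool)^(bool \<times> bool)) $ (a, b) $ (d, c)"
    by simp
  then have "(\<Sum>k\<in>UNIV. (\<Sum>j\<in>{1..4}. cnj (P j (a, b)) * of_real (sic_kernel j (e k)) / 4) * P (e k) (d, c))
      = (if a = d \<and> b = c then 1 else 0)"
    by (simp add: matrix_matrix_mult_def mat_def B_def C_def)
  then have "(\<Sum>i\<in>{1..4}. (\<Sum>j\<in>{1..4}. cnj (P j (a, b)) * of_real (sic_kernel j i) / 4) * P i (d, c))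
      = (if a = d \<and> b = c then 1 else 0)"
    by (subst (asm) sum.reindex_bij_betw [OF e, where g = "\<lambda>i. (\<Sum>j\<in>{1..4}. cnj (P j (a, b)) * of_real (sic_kernel j i) / 4) * P i (d, c)"])
  moreover have "(\<Sum>i\<in>{1..4}. \<Sum>j\<in>{1..4}. of_real (sic_kernel i j) * (cnj (\<psi> i a) * \<psi> i b) * (cnj (\<psi> j c) * \<psi> j d))
      = 4 * (\<Sum>i\<in>{1..4}. (\<Sum>j\<in>{1..4}. cnj (P j (a, b)) * of_real (sic_kernel j i) / 4) * P i (d, c))"
    by (subst sum.swap) (simp add: sum_distrib_left sum_distrib_right P_def mult_ac)
  ultimately show ?thesis
    by simp
qed

text \<open>The POVM property follows from the overlaps: tracing out the second factor in
  \<open>SIC_frame\<close> turns the swap into the identity, while each row of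
  \<open>sic_kernel\<close> sums to 5 - 3 = 2.\<close>

lemma SIC_resolution:
  assumes "SIC_set \<psi>"
  shows "(\<Sum>i\<in>{1..4}. cnj (\<psi> i a) * \<psi> i b) = (if a = b then 2 else 0)"
proof -
  have "(\<Sum>c\<in>UNIV. \<Sum>i\<in>{1..4}. \<Sum>j\<in>{1..4}. of_real (sic_kernel i j) * (cnj (\<psi> i a) * \<psi> i b) * (cnj (\<psi> j c) * \<psi> j c))
    = (\<Sum>i\<in>{1..4}. \<Sum>j\<in>{1..4}. of_real (sic_kernel i j) * (cnj (\<psi> i a) * \<psi> i b) * (\<Sum>c\<in>UNIV. \<psi> j c * cnj (\<psi> j c)))"
    by (simp add: UNIV_bool sum.distrib algebra_simps)
  also have "\<dots> = (\<Sum>i\<in>{1..4}. \<Sum>j\<in>{1..4}. of_real (sic_kernel i j) * (cnj (\<psi> i a) * \<psi> i b))"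
    by (intro sum.cong refl) (simp only: SIC_norm [OF assms] mult_1_right)
  also have "\<dots> = 2 * (\<Sum>i\<in>{1..4}. cnj (\<psi> i a) * \<psi> i b)"
    unfolding sum_1_4 by (simp add: sic_kernel_def algebra_simps)
  finally show ?thesis
    by (simp only: SIC_frame [OF assms]) (auto simp: UNIV_bool)
qed

lemma SIC_shadow_overlap:
  assumes "SIC_set \<psi>" "i \<in> {1..4}" "j \<in> {1..4}"
  shows "(\<Sum>a\<in>UNIV. \<Sum>b\<in>UNIV. (3 * \<psi> i a * cnj (\<psi> i b) - (if a = b then 1 else 0))
      * (3 * \<psi> j b * cnj (\<psi> j a) - (if b = a then 1 else 0))) = of_real (sic_kernel i j)"
proof -
  have "(\<Sum>a\<in>UNIV. \<Sum>b\<in>UNIV. (3 * \<psi> i a * cnj (\<psi> i b) - (if a = b then 1 else 0))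
      * (3 * \<psi> j b * cnj (\<psi> j a) - (if b = a then 1 else 0)))
    = 9 * (\<Sum>a\<in>UNIV. \<Sum>b\<in>UNIV. (\<psi> i a * cnj (\<psi> i b)) * (\<psi> j b * cnj (\<psi> j a)))
      - 3 * (\<Sum>b\<in>UNIV. \<psi> i b * cnj (\<psi> i b)) - 3 * (\<Sum>b\<in>UNIV. \<psi> j b * cnj (\<psi> j b)) + 2"
    by (simp add: UNIV_bool algebra_simps)
  then show ?thesis
    unfolding SIC_norm [OF assms(1,2)] SIC_norm [OF assms(1,3)] SIC_trace [OF assms]
    by (simp add: sic_kernel_def)
qed

section \<open>Partial traces of product operators and overlaps of shadows\<close>

lemma ptrace_prod:
  assumes "K \<subseteq> {..<N}"
  shows "ptrace N K (\<lambda>x y. \<Prod>n<N. f n (x n) (y n)) a b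
    = (\<Prod>n\<in>K. f n (a n) (b n)) * (\<Prod>n\<in>{..<N} - K. \<Sum>c\<in>UNIV. f n c c)"
proof -
  have "(\<Prod>n<N. f n (glue K a z n) (glue K b z n))
      = (\<Prod>n\<in>K. f n (a n) (b n)) * (\<Prod>n\<in>{..<N} - K. f n (z n) (z n))" for z
  proof -
    have "finite K"
      using assms finite_subset by blast
    then have "(\<Prod>n<N. f n (glue K a z n) (glue K b z n))
      = (\<Prod>n\<in>K. f n (glue K a z n) (glue K b z n)) * (\<Prod>n\<in>{..<N} - K. f n (glue K a z n) (glue K b z n))"
      using assms by (subst prod.subset_diff [of K]) (auto simp: mult.commute)
    then show ?thesis
      by (simp add: glue_def)
  qed
  then show ?thesis
    by (simp add: ptrace_def sum_qstr_prod [of _ "\<lambda>n c. f n c c"] flip: sum_distrib_left)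
qed

definition shadow_kernel :: "nat set \<Rightarrow> (nat \<Rightarrow> nat) \<Rightarrow> (nat \<Rightarrow> nat) \<Rightarrow> real" where
  "shadow_kernel K s t = (\<Prod>n\<in>K. sic_kernel (s n) (t n))"

text \<open>A single-qubit shadow has trace 3 - 2 = 1, so the discarded qubits leave no factor; on
  \<open>K\<close> the double sum over basis strings factors into single-qubit overlaps.\<close>

lemma tr_prod_shadows:
  assumes "SIC_set \<psi>" "K \<subseteq> {..<N}" "s \<in> outcomes N" "t \<in> outcomes N"
  shows "tr_prod K (ptrace N K (sic_shadow \<psi> N s)) (ptrace N K (sic_shadow \<psi> N t))
    = of_real (shadow_kernel K s t)"
proof -
  define f where "f i a b = 3 * \<psi> i a * cnj (\<psi> i b) - (if a = b then 1 else 0)" for i a b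
  have K: "finite K"
    using assms(2) finite_subset by blast
  have range: "u n \<in> {1..4}" if "u \<in> outcomes N" "n < N" for u n
    using that by (auto simp: outcomes_def)
  have pt: "ptrace N K (sic_shadow \<psi> N u) = (\<lambda>a b. \<Prod>n\<in>K. f (u n) (a n) (b n))" if "u \<in> outcomes N" for u
  proof (intro ext)
    fix a b
    have "(\<Sum>c\<in>UNIV. f (u n) c c) = 1" if "n < N" for n
      using SIC_norm [OF assms(1) range [OF \<open>u \<in> outcomes N\<close> that]] by (simp add: f_def UNIV_bool mult.assoc flip: distrib_left)
    moreover have "sic_shadow \<psi> N u = (\<lambda>x y. \<Prod>n<N. f (u n) (x n) (y n))"
      by (simp add: fun_eq_iff sic_shadow_def f_def)
    ultimately show "ptrace N K (sic_shadow \<psi> N u) a b = (\<Prod>n\<in>K. f (u n) (a n) (b n))"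
      by (simp add: ptrace_prod [OF assms(2), of "\<lambda>n. f (u n)"])
  qed
  have "tr_prod K (ptrace N K (sic_shadow \<psi> N s)) (ptrace N K (sic_shadow \<psi> N t))
    = (\<Sum>x\<in>qstr K. \<Sum>y\<in>qstr K. \<Prod>n\<in>K. f (s n) (x n) (y n) * f (t n) (y n) (x n))"
    by (simp add: pt assms(3,4) tr_prod_def prod.distrib)
  also have "\<dots> = (\<Prod>n\<in>K. \<Sum>a\<in>UNIV. \<Sum>b\<in>UNIV. f (s n) a b * f (t n) b a)"
    by (simp add: sum_qstr_prod [OF K, of "\<lambda>n b. f (s n) (_ n) b * f (t n) b (_ n)"]
        sum_qstr_prod [OF K, of "\<lambda>n a. \<Sum>b\<in>UNIV. f (s n) a b * f (t n) b a"])
  also have "\<dots> = (\<Prod>n\<in>K. of_real (sic_kernel (s n) (t n)))"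
    unfolding f_def using assms range by (intro prod.cong refl SIC_shadow_overlap) auto
  finally show ?thesis
    by (simp add: shadow_kernel_def)
qed

section \<open>Outcome statistics of the SIC measurement\<close>

locale sic_measurement =
  fixes \<psi> :: "nat \<Rightarrow> bool \<Rightarrow> complex" and N :: nat and \<rho> :: qop
  assumes sic: "SIC_set \<psi>" and density: "density_matrix N \<rho>"
begin

abbreviation "basis \<equiv> qstr {..<N}"
abbreviation "prob \<equiv> outcome_prob \<psi> N \<rho>"

text \<open>Moduli of a fictitious pure state: by \<open>sum_amp_square\<close> they form a unit
  vector, and by \<open>entry_bound\<close> their products dominate the entries of
  \<open>\<rho>\<close>, which opens the way to Cauchy-Schwarz.\<close>

definition amp :: "(nat \<Rightarrow> bool) \<Rightarrow> real" where
  "amp x = sqrt (Re (\<rho> x x))"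

section \<open>Entries of a density matrix\<close>

lemma finite_basis: "finite basis"
  by (simp add: finite_qstr)

lemma hermitian: "x \<in> basis \<Longrightarrow> y \<in> basis \<Longrightarrow> \<rho> y x = cnj (\<rho> x y)"
  using density unfolding density_matrix_def by blast

lemma positive: "0 \<le> Re (\<Sum>x\<in>basis. \<Sum>y\<in>basis. cnj (v x) * \<rho> x y * v y)"
  using density unfolding density_matrix_def by blast

lemma trace_eq_1: "(\<Sum>x\<in>basis. \<rho> x x) = 1"
  using density unfolding density_matrix_def by blast

lemma Im_diagonal: "x \<in> basis \<Longrightarrow> Im (\<rho> x x) = 0"
  using hermitian [of x x] unfolding complex_eq_iff by simp

text \<open>Positivity tested on a vector supported on two basis strings, that is, on a principal 2
  by 2 submatrix.\<close>

lemma positive_on_pair: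
  assumes "x \<in> basis" "y \<in> basis" "x \<noteq> y"
  shows "0 \<le> Re (cnj a * \<rho> x x * a + cnj a * \<rho> x y * b + (cnj b * \<rho> y x * a + cnj b * \<rho> y y * b))"
proof -
  define v where "v w = (if w = x then a else if w = y then b else 0)" for w
  have restrict: "(\<Sum>w\<in>basis. f w * v w) = f x * a + f y * b" "(\<Sum>w\<in>basis. cnj (v w) * f w) = cnj a * f x + cnj b * f y" for f
  proof -
    have "(\<Sum>w\<in>basis. f w * v w) = (\<Sum>w\<in>{x, y}. f w * v w)"
      by (rule sum.mono_neutral_right) (use assms finite_basis in \<open>auto simp: v_def\<close>)
    moreover have "(\<Sum>w\<in>basis. cnj (v w) * f w) = (\<Sum>w\<in>{x, y}. cnj (v w) * f w)"
      by (rule sum.mono_neutral_right) (use assms finite_basis in \<open>auto simp: v_def\<close>)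
    ultimately show "(\<Sum>w\<in>basis. f w * v w) = f x * a + f y * b" "(\<Sum>w\<in>basis. cnj (v w) * f w) = cnj a * f x + cnj b * f y"
      using assms(3) by (simp_all add: v_def)
  qed
  have "(\<Sum>z\<in>basis. \<Sum>w\<in>basis. cnj (v z) * \<rho> z w * v w) = (\<Sum>z\<in>basis. cnj (v z) * (\<Sum>w\<in>basis. \<rho> z w * v w))"
    by (simp add: sum_distrib_left mult.assoc)
  also have "\<dots> = cnj a * \<rho> x x * a + cnj a * \<rho> x y * b + (cnj b * \<rho> y x * a + cnj b * \<rho> y y * b)"
    by (simp only: restrict) (simp add: algebra_simps)
  finally show ?thesis
    using positive [of v] by simp
qed

lemma diagonal_nonneg:
  assumes "x \<in> basis"
  shows "0 \<le> Re (\<rho> x x)"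
proof -
  define v where "v w = (if w = x then 1 else 0 :: complex)" for w
  have "(\<Sum>z\<in>basis. \<Sum>w\<in>basis. cnj (v z) * \<rho> z w * v w)
      = (\<Sum>z\<in>basis. \<Sum>w\<in>basis. if w = x then (if z = x then \<rho> x x else 0) else 0)"
    by (intro sum.cong refl) (auto simp: v_def)
  then show ?thesis
    using positive [of v] assms finite_basis by simp
qed

lemma amp_square: "x \<in> basis \<Longrightarrow> (amp x)\<^sup>2 = Re (\<rho> x x)"
  by (simp add: amp_def diagonal_nonneg)

lemma amp_nonneg: "x \<in> basis \<Longrightarrow> 0 \<le> amp x"
  by (simp add: amp_def diagonal_nonneg)

lemma sum_amp_square: "(\<Sum>x\<in>basis. (amp x)\<^sup>2) = 1"
proof -
  have "(\<Sum>x\<in>basis. (amp x)\<^sup>2) = Re (\<Sum>x\<in>basis. \<rho> x x)"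
    by (simp add: amp_square)
  then show ?thesis
    by (simp add: trace_eq_1)
qed

text \<open>Cauchy-Schwarz for positive semidefinite matrices, obtained from a nonnegative real
  quadratic form in two variables.\<close>

lemma entry_bound:
  assumes "x \<in> basis" "y \<in> basis"
  shows "cmod (\<rho> x y) \<le> amp x * amp y"
proof (cases "x = y")
  case True
  then show ?thesis
    using amp_square [OF assms(1)] diagonal_nonneg [OF assms(1)] Im_diagonal [OF assms(1)]
    by (simp add: cmod_def power2_eq_square)
next
  case False
  define c where "c = cmod (\<rho> x y)"
  define A where "A = Re (\<rho> x x)"
  define B where "B = Re (\<rho> y y)"
  have nonneg: "0 \<le> A" "0 \<le> B" "0 \<le> c"
    using assms by (simp_all add: A_def B_def c_def diagonal_nonneg)
  have quad: "0 \<le> r\<^sup>2 * A + q\<^sup>2 * B - 2 * r * q * c" for r q :: real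
  proof -
    \<comment> \<open>The phase \<open>w\<close> rotates the off-diagonal entry onto the negative
      real axis, the worst case for positivity.\<close>
    have "\<exists>w. cmod w = 1 \<and> \<rho> x y * w = - of_real c"
    proof (cases "c = 0")
      case True
      then show ?thesis
        by (intro exI [of _ 1]) (simp add: c_def)
    next
      case False
      have "\<rho> x y * cnj (\<rho> x y) = of_real c * of_real c"
        using complex_norm_square [of "\<rho> x y"] by (simp add: c_def power2_eq_square)
      then have "\<rho> x y * (- cnj (\<rho> x y) / of_real c) = - (of_real c)"
        using False by simp
      moreover have "cmod (- cnj (\<rho> x y) / of_real c) = 1"
        using False by (simp add: c_def norm_divide)
      ultimately show ?thesis
        by blast
    qed
    then obtain w where w: "cmod w = 1" "\<rho> x y * w = - of_real c"
      by blast
    have ww: "cnj w * w = 1"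
      using w(1) complex_norm_square [of w] by (simp add: mult.commute)
    have 1: "of_real r * \<rho> x y * (of_real q * w) = - of_real (r * q * c)"
    proof -
      have "of_real r * \<rho> x y * (of_real q * w) = of_real (r * q) * (\<rho> x y * w)"
        by (simp add: mult_ac)
      then show ?thesis
        by (simp add: w(2))
    qed
    have 2: "cnj (of_real q * w) * \<rho> y x * of_real r = - of_real (r * q * c)"
    proof -
      have "cnj (of_real q * w) * \<rho> y x * of_real r = cnj (of_real r * \<rho> x y * (of_real q * w))"
        using hermitian [OF assms] by (simp add: mult_ac)
      then show ?thesis
        unfolding 1 by simp
    qed
    have 3: "cnj (of_real q * w) * \<rho> y y * (of_real q * w) = of_real (q\<^sup>2) * \<rho> y y * (cnj w * w)"
      by (simp add: power2_eq_square mult_ac)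
    have 4: "cnj (of_real r) * \<rho> x x * of_real r = of_real (r\<^sup>2) * \<rho> x x"
      by (simp add: power2_eq_square mult_ac)
    show ?thesis
      using positive_on_pair [OF assms False, of "of_real r" "of_real q * w"]
      unfolding 2 3 4 ww complex_cnj_complex_of_real 1
      by (simp add: A_def B_def power2_eq_square mult_ac)
  qed
  have "c\<^sup>2 \<le> A * B"
  proof (cases "B = 0")
    case True
    have "c = 0"
    proof (rule ccontr)
      assume "c \<noteq> 0"
      \<comment> \<open>For \<open>B = 0\<close> these values make the quadratic form equal to
        \<open>A - (A + 1)\<close>, which is negative.\<close>
      then show False
        using quad [of 1 "(A + 1) / (2 * c)"] True by simp
    qed
    then show ?thesis
      using nonneg by simp
  next
    case False
    \<comment> \<open>At \<open>r = B\<close> and \<open>q = c\<close> the form is \<open>B\<close>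
      times the determinant of the submatrix.\<close>
    have "0 \<le> B * (A * B - c\<^sup>2)"
      using quad [of B c] by (simp add: power2_eq_square algebra_simps)
    then show ?thesis
      using False nonneg by (simp add: zero_le_mult_iff)
  qed
  also have "A * B = (amp x * amp y)\<^sup>2"
    using assms by (simp add: A_def B_def amp_square power_mult_distrib)
  finally show ?thesis
    using amp_nonneg assms by (simp add: c_def power2_le_iff_abs_le)
qed

section \<open>Outcome probabilities as complex sums\<close>

definition cprob :: "(nat \<Rightarrow> nat) \<Rightarrow> complex" where
  "cprob s = (1 / 2 ^ N) * (\<Sum>x\<in>basis. \<Sum>y\<in>basis.
     cnj (prod_state \<psi> N s x) * \<rho> x y * prod_state \<psi> N s y)"

text \<open>A Hermitian quadratic form is real, so identities for entries may be derived over the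
  complex numbers and read off for \<open>prob\<close>.\<close>

lemma cprob_eq: "cprob s = of_real (prob s)"
proof -
  let ?X = "\<Sum>x\<in>basis. \<Sum>y\<in>basis. cnj (prod_state \<psi> N s x) * \<rho> x y * prod_state \<psi> N s y"
  have "cnj ?X = (\<Sum>x\<in>basis. \<Sum>y\<in>basis. cnj (prod_state \<psi> N s y) * \<rho> y x * prod_state \<psi> N s x)"
    unfolding cnj_sum by (intro sum.cong refl) (simp add: hermitian [symmetric] mult_ac)
  also have "\<dots> = ?X"
    by (rule sum.swap)
  finally have "cnj ?X = ?X" .
  moreover have "of_real (Re z) = z" if "cnj z = z" for z
    using that by (simp add: complex_eq_iff)
  ultimately have "of_real (Re ?X) = ?X"
    by blast
  then show ?thesis
    unfolding cprob_def outcome_prob_def of_real_mult by (simp only:) simp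
qed

lemma prob_nonneg: "0 \<le> prob s"
  unfolding outcome_prob_def using positive [of "prod_state \<psi> N s"] by simp

text \<open>The expectation of a product function of the outcomes is the trace of
  \<open>\<rho>\<close> against a product operator. Normalisation, the kernel mean and the marginals
  are all computed from this formula by choosing \<open>f\<close>.\<close>

lemma sum_cprob_prod:
  "(\<Sum>s\<in>outcomes N. cprob s * (\<Prod>n<N. f n (s n)))
    = (\<Sum>x\<in>basis. \<Sum>y\<in>basis. \<rho> x y * (\<Prod>n<N. \<Sum>i\<in>{1..4}. f n i * (cnj (\<psi> i (x n)) * \<psi> i (y n)) / 2))"
proof -
  have eq: "\<rho> x y * (\<Prod>n<N. \<Sum>i\<in>{1..4}. f n i * (cnj (\<psi> i (x n)) * \<psi> i (y n)) / 2)
      = (\<Sum>s\<in>outcomes N. (1 / 2 ^ N) * (cnj (prod_state \<psi> N s x) * \<rho> x y * prod_state \<psi> N s y) * (\<Prod>n<N. f n (s n)))" for x y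
  proof -
    have "(\<Prod>n<N. \<Sum>i\<in>{1..4}. f n i * (cnj (\<psi> i (x n)) * \<psi> i (y n)) / 2)
        = (\<Sum>s\<in>outcomes N. \<Prod>n<N. f n (s n) * (cnj (\<psi> (s n) (x n)) * \<psi> (s n) (y n)) / 2)"
      unfolding outcomes_eq
      by (rule sum_outcomes_prod [OF finite_lessThan, symmetric, of "\<lambda>n i. f n i * (cnj (\<psi> i (x n)) * \<psi> i (y n)) / 2"])
    then show ?thesis
      by (simp add: sum_distrib_left prod.distrib prod_dividef prod_state_def mult_ac)
  qed
  show ?thesis
    by (simp only: eq cprob_def sum_distrib_left sum_distrib_right sum.swap [of _ basis "outcomes N"])
qed

lemma SIC_half: "(\<Sum>i\<in>{1..4}. cnj (\<psi> i a) * \<psi> i b / 2) = (if a = b then 1 else 0)"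
  using SIC_resolution [OF sic, of a b] by (simp flip: sum_divide_distrib)

lemma prod_indicator: "finite I \<Longrightarrow> (\<Prod>n\<in>I. if P n then 1 else (0::complex)) = (if \<forall>n\<in>I. P n then 1 else 0)"
  by (induction I rule: finite_induct) auto

lemma basis_eq_iff: "x \<in> basis \<Longrightarrow> y \<in> basis \<Longrightarrow> (\<forall>n\<in>{..<N}. x n = y n) \<longleftrightarrow> x = y"
  unfolding qstr_def fun_eq_iff by (metis (no_types, lifting) mem_Collect_eq)

lemma sum_cprob: "(\<Sum>s\<in>outcomes N. cprob s) = 1"
proof -
  have "(\<Sum>s\<in>outcomes N. cprob s) = (\<Sum>x\<in>basis. \<Sum>y\<in>basis. \<rho> x y * (\<Prod>n<N. if x n = y n then 1 else 0))"
    using sum_cprob_prod [of "\<lambda>_ _. 1"]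
    by (simp only: mult_1_left mult_1_right prod.neutral_const SIC_half)
  also have "\<dots> = (\<Sum>x\<in>basis. \<Sum>y\<in>basis. if x = y then \<rho> x y else 0)"
    by (intro sum.cong refl) (simp add: prod_indicator basis_eq_iff del: lessThan_iff)
  finally show ?thesis
    using finite_basis trace_eq_1 by simp
qed

lemma sum_prob: "(\<Sum>s\<in>outcomes N. prob s) = 1"
  using sum_cprob by (simp add: cprob_eq flip: of_real_sum)

section \<open>Purities and marginals of the state\<close>

lemma glue_in_basis: "x \<in> basis \<Longrightarrow> y \<in> basis \<Longrightarrow> glue K x y \<in> basis"
  by (auto simp: qstr_def glue_def)

text \<open>On each qubit of \<open>K\<close> the kernel averages to the swap by
  \<open>SIC_frame\<close>, on every other qubit to the identity by the POVM property. The double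
  sum is therefore the trace of two copies of \<open>\<rho>\<close> against the swap on
  \<open>K\<close>, which is the purity.\<close>

lemma sum_cprob_kernel:
  assumes K: "K \<subseteq> {..<N}"
  shows "(\<Sum>s\<in>outcomes N. \<Sum>t\<in>outcomes N. cprob s * cprob t * of_real (shadow_kernel K s t))
    = tr_prod K (ptrace N K \<rho>) (ptrace N K \<rho>)"
proof -
  define f :: "nat \<Rightarrow> nat \<Rightarrow> nat \<Rightarrow> complex" where
    "f n i j = (if n \<in> K then of_real (sic_kernel i j) else 1)" for n i j
  have f: "of_real (shadow_kernel K s t) = (\<Prod>n<N. f n (s n) (t n))" for s t
    using K by (simp add: f_def shadow_kernel_def flip: prod.inter_restrict) (simp add: Int_absorb1)
  \<comment> \<open>The single-qubit sum left by applying \<open>sum_cprob_prod\<close> first to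
    \<open>t\<close> and then to \<open>s\<close>. The two factors 1/2 cancel the 4 of
    \<open>SIC_frame\<close>.\<close>
  have inner: "(\<Sum>i\<in>{1..4}. (\<Sum>j\<in>{1..4}. f n i j * (cnj (\<psi> j c) * \<psi> j d) / 2) * (cnj (\<psi> i a) * \<psi> i b) / 2)
      = (if (if n \<in> K then b = c \<and> d = a else b = a \<and> d = c) then 1 else 0)" for n a b c d
  proof (cases "n \<in> K")
    case True
    have "(\<Sum>i\<in>{1..4}. (\<Sum>j\<in>{1..4}. f n i j * (cnj (\<psi> j c) * \<psi> j d) / 2) * (cnj (\<psi> i a) * \<psi> i b) / 2)
      = (\<Sum>i\<in>{1..4}. \<Sum>j\<in>{1..4}. of_real (sic_kernel i j) * (cnj (\<psi> i a) * \<psi> i b) * (cnj (\<psi> j c) * \<psi> j d)) / 4"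
      unfolding sum_distrib_right sum_divide_distrib
      using True by (intro sum.cong refl) (simp add: f_def)
    then show ?thesis
      unfolding SIC_frame [OF sic] using True by auto
  next
    case False
    then have "(\<Sum>i\<in>{1..4}. (\<Sum>j\<in>{1..4}. f n i j * (cnj (\<psi> j c) * \<psi> j d) / 2) * (cnj (\<psi> i a) * \<psi> i b) / 2)
      = (\<Sum>j\<in>{1..4}. cnj (\<psi> j c) * \<psi> j d / 2) * (\<Sum>i\<in>{1..4}. cnj (\<psi> i a) * \<psi> i b / 2)"
      by (simp add: f_def sum_distrib_left)
    then show ?thesis
      unfolding SIC_half using False by auto
  qed
  \<comment> \<open>The index constraints say that the column strings arise from the row strings by
    exchanging their parts on \<open>K\<close>.\<close>
  have swap_iff: "(\<forall>n\<in>{..<N}. if n \<in> K then y n = u n \<and> v n = x n else y n = x n \<and> v n = u n)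
      \<longleftrightarrow> y = glue K u x \<and> v = glue K x u"
    if "x \<in> basis" "y \<in> basis" "u \<in> basis" "v \<in> basis" for x y u v
  proof -
    have "(\<forall>n\<in>{..<N}. if n \<in> K then y n = u n \<and> v n = x n else y n = x n \<and> v n = u n)
      \<longleftrightarrow> (\<forall>n\<in>{..<N}. y n = glue K u x n) \<and> (\<forall>n\<in>{..<N}. v n = glue K x u n)"
      by (auto simp: glue_def)
    then show ?thesis
      using that by (simp only: basis_eq_iff glue_in_basis)
  qed
  have "(\<Sum>s\<in>outcomes N. \<Sum>t\<in>outcomes N. cprob s * cprob t * of_real (shadow_kernel K s t))
    = (\<Sum>s\<in>outcomes N. cprob s * (\<Sum>t\<in>outcomes N. cprob t * (\<Prod>n<N. f n (s n) (t n))))"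
    by (simp add: f sum_distrib_left mult.assoc)
  also have "\<dots> = (\<Sum>s\<in>outcomes N. cprob s * (\<Sum>u\<in>basis. \<Sum>v\<in>basis. \<rho> u v *
      (\<Prod>n<N. \<Sum>j\<in>{1..4}. f n (s n) j * (cnj (\<psi> j (u n)) * \<psi> j (v n)) / 2)))"
    by (intro sum.cong refl) (simp only: sum_cprob_prod [of "\<lambda>n. f n (_ n)"])
  also have "\<dots> = (\<Sum>u\<in>basis. \<Sum>v\<in>basis. \<rho> u v * (\<Sum>s\<in>outcomes N. cprob s *
      (\<Prod>n<N. \<Sum>j\<in>{1..4}. f n (s n) j * (cnj (\<psi> j (u n)) * \<psi> j (v n)) / 2)))"
    by (simp only: sum_distrib_left sum.swap [of _ basis "outcomes N"] mult.left_commute [of "cprob _" "\<rho> _ _"])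
  also have "\<dots> = (\<Sum>u\<in>basis. \<Sum>v\<in>basis. \<rho> u v * (\<Sum>x\<in>basis. \<Sum>y\<in>basis. \<rho> x y *
      (\<Prod>n<N. if (if n \<in> K then y n = u n \<and> v n = x n else y n = x n \<and> v n = u n) then 1 else 0)))"
    by (subst sum_cprob_prod [of "\<lambda>n i. \<Sum>j\<in>{1..4}. f n i j * (cnj (\<psi> j (_ n)) * \<psi> j (_ n)) / 2"])
      (simp only: inner)
  also have "\<dots> = (\<Sum>u\<in>basis. \<Sum>v\<in>basis. \<Sum>x\<in>basis. \<Sum>y\<in>basis.
      if y = glue K u x then (if v = glue K x u then \<rho> u v * \<rho> x y else 0) else 0)"
    unfolding sum_distrib_left
    by (intro sum.cong refl) (simp add: prod_indicator swap_iff del: lessThan_iff)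
  also have "\<dots> = (\<Sum>u\<in>basis. \<Sum>x\<in>basis. \<Sum>v\<in>basis.
      if v = glue K x u then \<rho> u v * \<rho> x (glue K u x) else 0)"
    by (subst sum.swap [of _ basis basis]) (simp add: finite_basis glue_in_basis cong: if_cong)
  also have "\<dots> = (\<Sum>u\<in>basis. \<Sum>x\<in>basis. \<rho> u (glue K x u) * \<rho> x (glue K u x))"
    by (simp add: finite_basis glue_in_basis)
  also have "\<dots> = (\<Sum>a\<in>qstr K. \<Sum>z\<in>qstr ({..<N} - K). \<Sum>b\<in>qstr K. \<Sum>w\<in>qstr ({..<N} - K).
      \<rho> (glue K a z) (glue K b z) * \<rho> (glue K b w) (glue K a w))"
  proof -
    have "glue K (glue K b w) (glue K a z) = glue K b z" for a b z w
      by (auto simp: glue_def)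
    then show ?thesis
      by (simp add: sum_qstr_glue [OF K])
  qed
  also have "\<dots> = tr_prod K (ptrace N K \<rho>) (ptrace N K \<rho>)"
    unfolding tr_prod_def ptrace_def sum_product
    by (rule sum.cong [OF refl]) (rule sum.swap)
  finally show ?thesis .
qed

text \<open>\<open>R\<close> is the diagonal of the marginal. By \<open>entry_bound\<close> and
  Cauchy-Schwarz each squared entry is at most \<open>R a * R b\<close>, and these products sum to
  the squared trace.\<close>

lemma purity_bound:
  assumes K: "K \<subseteq> {..<N}"
  shows "cmod (tr_prod K (ptrace N K \<rho>) (ptrace N K \<rho>)) \<le> 1"
proof -
  let ?Z = "qstr ({..<N} - K)"
  define R where "R a = (\<Sum>z\<in>?Z. (amp (glue K a z))\<^sup>2)" for a
  have mem: "glue K a z \<in> basis" if "a \<in> qstr K" "z \<in> ?Z" for a z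
    using that K by (auto simp: glue_def qstr_def)
  have entry: "cmod (ptrace N K \<rho> a b) \<le> (\<Sum>z\<in>?Z. amp (glue K a z) * amp (glue K b z))"
    if "a \<in> qstr K" "b \<in> qstr K" for a b
    unfolding ptrace_def using that by (intro order_trans [OF norm_sum] sum_mono entry_bound mem)
  have "cmod (tr_prod K (ptrace N K \<rho>) (ptrace N K \<rho>)) \<le> (\<Sum>a\<in>qstr K. \<Sum>b\<in>qstr K. R a * R b)"
    unfolding tr_prod_def
  proof (intro order_trans [OF norm_sum] sum_mono)
    fix a b assume ab: "a \<in> qstr K" "b \<in> qstr K"
    let ?c = "\<Sum>z\<in>?Z. amp (glue K a z) * amp (glue K b z)"
    have "cmod (ptrace N K \<rho> a b * ptrace N K \<rho> b a) \<le> ?c * ?c"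
      unfolding norm_mult using entry [OF ab] entry [OF ab(2,1)]
      by (intro mult_mono) (auto simp: mult.commute intro: order_trans [OF norm_ge_zero])
    also have "\<dots> \<le> R a * R b"
      unfolding R_def power2_eq_square [of ?c, symmetric] by (rule Cauchy_Schwarz_ineq_sum)
    finally show "cmod (ptrace N K \<rho> a b * ptrace N K \<rho> b a) \<le> R a * R b" .
  qed
  also have "\<dots> = (\<Sum>a\<in>qstr K. R a)\<^sup>2"
    by (simp add: power2_eq_square sum_product)
  also have "(\<Sum>a\<in>qstr K. R a) = 1"
    using sum_amp_square by (simp add: R_def sum_qstr_glue [OF K])
  finally show ?thesis
    by simp
qed

text \<open>The left side is \<open>(1/2) ^ card K\<close> times the expectation of the marginal in
  the product unit vector \<open>\<Phi>\<close>. For each environment string \<open>z\<close> the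
  entry bounds add up to the square of an inner product, so Cauchy-Schwarz and the unit trace bound
  that expectation by 1.\<close>

lemma marginal_bound:
  assumes K: "K \<subseteq> {..<N}" and t: "t \<in> outcomes_on K"
  shows "(\<Sum>s\<in>outcomes N. prob s * (if \<forall>n\<in>K. s n = t n then 1 else 0)) \<le> (1/2) ^ card K"
proof -
  let ?Z = "qstr ({..<N} - K)"
  have finK: "finite K"
    using K finite_subset by blast
  define \<Phi> where "\<Phi> x = (\<Prod>n\<in>K. \<psi> (t n) (x n))" for x
  define f :: "nat \<Rightarrow> nat \<Rightarrow> complex" where "f n i = (if n \<in> K then (if i = t n then 1 else 0) else 1)" for n i
  have mem: "glue K a z \<in> basis" if "a \<in> qstr K" "z \<in> ?Z" for a z
    using that K by (auto simp: glue_def qstr_def)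
  have f: "(if \<forall>n\<in>K. s n = t n then 1 else 0) = (\<Prod>n<N. f n (s n))" for s
    using K finK by (simp add: f_def prod_indicator Int_absorb1 flip: prod.inter_restrict)
  have inner: "(\<Sum>i\<in>{1..4}. f n i * (cnj (\<psi> i a) * \<psi> i b) / 2)
      = (if n \<in> K then cnj (\<psi> (t n) a) * \<psi> (t n) b / 2 else if a = b then 1 else 0)" for n a b
  proof (cases "n \<in> K")
    case True
    then have "t n \<in> {1..4}"
      using t by (simp add: outcomes_on_def)
    have "(\<Sum>i\<in>{1..4}. f n i * (cnj (\<psi> i a) * \<psi> i b) / 2)
      = (\<Sum>i\<in>{1..4}. if i = t n then cnj (\<psi> i a) * \<psi> i b / 2 else 0)"
      using True by (intro sum.cong) (auto simp: f_def)
    then show ?thesis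
      using True \<open>t n \<in> {1..4}\<close> by simp
  next
    case False
    then show ?thesis
      using SIC_half [of a b] by (simp add: f_def)
  qed
  \<comment> \<open>Off \<open>K\<close> the POVM property forces equal environment strings; on
    \<open>K\<close> the factors assemble into the entries of \<open>\<Phi>\<close>.\<close>
  have split: "(\<Prod>n<N. if n \<in> K then cnj (\<psi> (t n) (glue K a z n)) * \<psi> (t n) (glue K b w n) / 2
        else if glue K a z n = glue K b w n then 1 else 0)
      = (if w = z then cnj (\<Phi> a) * \<Phi> b / 2 ^ card K else 0)"
    if "z \<in> ?Z" "w \<in> ?Z" for a b z w
  proof -
    have "(\<forall>n\<in>{..<N} - K. z n = w n) \<longleftrightarrow> w = z"
      using that unfolding qstr_def fun_eq_iff by (metis (no_types, lifting) mem_Collect_eq)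
    moreover have "(\<Prod>n<N. if n \<in> K then cnj (\<psi> (t n) (glue K a z n)) * \<psi> (t n) (glue K b w n) / 2
        else if glue K a z n = glue K b w n then 1 else 0)
      = (\<Prod>n<N. if n \<in> K then cnj (\<psi> (t n) (a n)) * \<psi> (t n) (b n) / 2 else if z n = w n then 1 else 0)"
      by (intro prod.cong) (auto simp: glue_def)
    moreover have "\<dots> = (\<Prod>n\<in>K. cnj (\<psi> (t n) (a n)) * \<psi> (t n) (b n) / 2)
        * (\<Prod>n\<in>{..<N} - K. if z n = w n then 1 else 0)"
    proof -
      have "{..<N} \<inter> {n. n \<in> K} = K" "{..<N} \<inter> - {n. n \<in> K} = {..<N} - K"
        using K by auto
      then show ?thesis
        by (simp only: prod.If_cases finite_lessThan)
    qed
    moreover have "(\<Prod>n\<in>K. cnj (\<psi> (t n) (a n)) * \<psi> (t n) (b n) / 2) = cnj (\<Phi> a) * \<Phi> b / 2 ^ card K"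
      by (simp add: \<Phi>_def prod_dividef prod.distrib)
    ultimately show ?thesis
      by (simp add: prod_indicator)
  qed
  have norm_\<Phi>: "(\<Sum>a\<in>qstr K. (cmod (\<Phi> a))\<^sup>2) = 1"
  proof -
    have "(\<Sum>a\<in>qstr K. (cmod (\<Phi> a))\<^sup>2) = (\<Sum>a\<in>qstr K. \<Prod>n\<in>K. (cmod (\<psi> (t n) (a n)))\<^sup>2)"
      by (simp add: \<Phi>_def prod_norm [symmetric] prod_power_distrib)
    also have "\<dots> = (\<Prod>n\<in>K. \<Sum>b\<in>UNIV. (cmod (\<psi> (t n) b))\<^sup>2)"
      by (rule sum_qstr_prod [OF finK])
    also have "\<dots> = 1"
      using sic t unfolding SIC_set_def outcomes_on_def by (intro prod.neutral) blast
    finally show ?thesis .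
  qed
  have abs_eq: "\<bar>r\<bar> = cmod z" if "of_real r = z" for r z
    by (simp flip: that)
  have "of_real (\<Sum>s\<in>outcomes N. prob s * (if \<forall>n\<in>K. s n = t n then 1 else 0))
      = (\<Sum>s\<in>outcomes N. cprob s * (if \<forall>n\<in>K. s n = t n then 1 else 0))"
    unfolding of_real_sum cprob_eq by (intro sum.cong refl) auto
  also have "\<dots> = (\<Sum>x\<in>basis. \<Sum>y\<in>basis. \<rho> x y *
      (\<Prod>n<N. if n \<in> K then cnj (\<psi> (t n) (x n)) * \<psi> (t n) (y n) / 2 else if x n = y n then 1 else 0))"
    unfolding f sum_cprob_prod inner ..
  also have "\<dots> = (\<Sum>a\<in>qstr K. \<Sum>z\<in>?Z. \<Sum>b\<in>qstr K. \<Sum>w\<in>?Z. if w = z then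
      \<rho> (glue K a z) (glue K b w) * (cnj (\<Phi> a) * \<Phi> b / 2 ^ card K) else 0)"
    unfolding sum_qstr_glue [OF K] by (intro sum.cong refl) (simp add: split)
  also have "\<dots> = (\<Sum>a\<in>qstr K. \<Sum>z\<in>?Z. \<Sum>b\<in>qstr K.
      \<rho> (glue K a z) (glue K b z) * (cnj (\<Phi> a) * \<Phi> b / 2 ^ card K))"
    by (simp add: finite_qstr)
  finally have "\<bar>\<Sum>s\<in>outcomes N. prob s * (if \<forall>n\<in>K. s n = t n then 1 else 0)\<bar>
      = cmod (\<Sum>a\<in>qstr K. \<Sum>z\<in>?Z. \<Sum>b\<in>qstr K. \<rho> (glue K a z) (glue K b z) * (cnj (\<Phi> a) * \<Phi> b / 2 ^ card K))"
    by (rule abs_eq)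
  also have "\<dots> \<le> (\<Sum>a\<in>qstr K. \<Sum>z\<in>?Z. \<Sum>b\<in>qstr K.
      (amp (glue K a z) * cmod (\<Phi> a)) * (amp (glue K b z) * cmod (\<Phi> b)) / 2 ^ card K)"
  proof (intro order_trans [OF norm_sum] sum_mono)
    fix a b z assume "a \<in> qstr K" "z \<in> ?Z" "b \<in> qstr K"
    then have "cmod (\<rho> (glue K a z) (glue K b z)) * (cmod (\<Phi> a) * cmod (\<Phi> b) / 2 ^ card K)
      \<le> amp (glue K a z) * amp (glue K b z) * (cmod (\<Phi> a) * cmod (\<Phi> b) / 2 ^ card K)"
      by (intro mult_right_mono entry_bound mem) auto
    then show "cmod (\<rho> (glue K a z) (glue K b z) * (cnj (\<Phi> a) * \<Phi> b / 2 ^ card K))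
      \<le> (amp (glue K a z) * cmod (\<Phi> a)) * (amp (glue K b z) * cmod (\<Phi> b)) / 2 ^ card K"
      by (simp add: norm_mult norm_divide norm_power mult_ac)
  qed
  also have "\<dots> = (\<Sum>z\<in>?Z. (\<Sum>a\<in>qstr K. amp (glue K a z) * cmod (\<Phi> a))\<^sup>2) / 2 ^ card K"
    by (subst sum.swap) (simp add: power2_eq_square sum_product sum_divide_distrib)
  also have "\<dots> \<le> (\<Sum>z\<in>?Z. (\<Sum>a\<in>qstr K. (amp (glue K a z))\<^sup>2) * (\<Sum>a\<in>qstr K. (cmod (\<Phi> a))\<^sup>2)) / 2 ^ card K"
    by (intro divide_right_mono sum_mono Cauchy_Schwarz_ineq_sum) auto
  also have "\<dots> = (1/2) ^ card K"
    using sum_amp_square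
    by (simp add: norm_\<Phi> sum_qstr_glue [OF K] sum.swap [of _ ?Z "qstr K"] power_divide)
  finally show ?thesis
    by simp
qed

section \<open>Moments of the shadow kernel\<close>

lemma kernel_mean:
  assumes "K \<subseteq> {..<N}"
  shows "of_real (\<Sum>s\<in>outcomes N. \<Sum>t\<in>outcomes N. prob s * prob t * shadow_kernel K s t)
    = tr_prod K (ptrace N K \<rho>) (ptrace N K \<rho>)"
  using sum_cprob_kernel [OF assms] by (simp add: cprob_eq)

lemma kernel_mean_le_1:
  assumes "K \<subseteq> {..<N}"
  shows "(\<Sum>s\<in>outcomes N. \<Sum>t\<in>outcomes N. prob s * prob t * shadow_kernel K s t) \<le> 1"
proof -
  have "\<bar>\<Sum>s\<in>outcomes N. \<Sum>t\<in>outcomes N. prob s * prob t * shadow_kernel K s t\<bar> \<le> 1"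
    using purity_bound [OF assms] unfolding kernel_mean [OF assms, symmetric] norm_of_real .
  then show ?thesis
    by simp
qed

text \<open>Writing the square on each qubit as \<open>4 * h + 5\<close> and expanding over subsets
  \<open>B\<close> of \<open>K\<close> leaves kernels on \<open>B\<close>, whose means are at most
  1; the coefficients add up to \<open>(4 + 5) ^ card K\<close>.\<close>

lemma kernel_second_moment:
  assumes K: "K \<subseteq> {..<N}"
  shows "(\<Sum>s\<in>outcomes N. \<Sum>t\<in>outcomes N. prob s * prob t * (shadow_kernel K s t)\<^sup>2) \<le> 9 ^ card K"
proof -
  have finK: "finite K"
    using K finite_subset by blast
  have "(shadow_kernel K s t)\<^sup>2 = (\<Sum>B\<in>Pow K. (4 ^ card B * 5 ^ card (K - B)) * shadow_kernel B s t)" for s t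
  proof -
    have "(shadow_kernel K s t)\<^sup>2 = (\<Prod>n\<in>K. 4 * sic_kernel (s n) (t n) + 5)"
      unfolding shadow_kernel_def prod_power_distrib
      by (intro prod.cong) (auto simp: sic_kernel_def)
    also have "\<dots> = (\<Sum>B\<in>Pow K. (\<Prod>n\<in>B. 4 * sic_kernel (s n) (t n)) * (\<Prod>n\<in>K - B. 5))"
      by (rule prod_add [OF finK])
    finally show ?thesis
      by (simp add: prod.distrib shadow_kernel_def mult_ac)
  qed
  then have "(\<Sum>s\<in>outcomes N. \<Sum>t\<in>outcomes N. prob s * prob t * (shadow_kernel K s t)\<^sup>2)
    = (\<Sum>s\<in>outcomes N. \<Sum>t\<in>outcomes N. \<Sum>B\<in>Pow K. (4 ^ card B * 5 ^ card (K - B)) * (prob s * prob t * shadow_kernel B s t))"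
    by (simp add: sum_distrib_left mult_ac)
  also have "\<dots> = (\<Sum>B\<in>Pow K. (4 ^ card B * 5 ^ card (K - B)) *
      (\<Sum>s\<in>outcomes N. \<Sum>t\<in>outcomes N. prob s * prob t * shadow_kernel B s t))"
    by (simp only: sum.swap [of _ "Pow K" "outcomes N"] sum_distrib_left)
  also have "\<dots> \<le> (\<Sum>B\<in>Pow K. (4 ^ card B * 5 ^ card (K - B)) * 1)"
    using K by (intro sum_mono mult_left_mono kernel_mean_le_1) auto
  also have "\<dots> = (\<Sum>B\<in>Pow K. (\<Prod>n\<in>B. 4) * (\<Prod>n\<in>K - B. 5))"
    by simp
  also have "\<dots> = (\<Prod>n\<in>K. 4 + 5)"
    by (rule prod_add [OF finK, symmetric])
  finally show ?thesis
    by simp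
qed

text \<open>A kernel of the form \<open>\<Sum>u\<in>T. g u s * g u t\<close> has a sum of squares as
  its quadratic form.\<close>

lemma sum_sum_square:
  fixes g :: "'b \<Rightarrow> (nat \<Rightarrow> nat) \<Rightarrow> real"
  shows "(\<Sum>u\<in>T. (\<Sum>s\<in>outcomes N. prob s * g u s)\<^sup>2)
    = (\<Sum>s\<in>outcomes N. \<Sum>t\<in>outcomes N. prob s * prob t * (\<Sum>u\<in>T. g u s * g u t))"
proof -
  have "(\<Sum>s\<in>outcomes N. \<Sum>t\<in>outcomes N. prob s * prob t * (\<Sum>u\<in>T. g u s * g u t))
    = (\<Sum>s\<in>outcomes N. \<Sum>t\<in>outcomes N. \<Sum>u\<in>T. (prob s * g u s) * (prob t * g u t))"
    by (simp add: sum_distrib_left mult_ac)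
  also have "\<dots> = (\<Sum>s\<in>outcomes N. \<Sum>u\<in>T. \<Sum>t\<in>outcomes N. (prob s * g u s) * (prob t * g u t))"
    by (intro sum.cong refl sum.swap)
  also have "\<dots> = (\<Sum>u\<in>T. \<Sum>s\<in>outcomes N. \<Sum>t\<in>outcomes N. (prob s * g u s) * (prob t * g u t))"
    by (rule sum.swap)
  finally show ?thesis
    by (simp add: power2_eq_square sum_product)
qed

lemma outcomes_range: "s \<in> outcomes N \<Longrightarrow> K \<subseteq> {..<N} \<Longrightarrow> n \<in> K \<Longrightarrow> s n \<in> {1..4}"
  by (auto simp: outcomes_def)

text \<open>In each coordinate \<open>\<delta> - 1/4\<close> and \<open>1/4\<close> are complementary projectors, so the quadratic
  form of a tensor product of them is a sum of squares.\<close>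

lemma projector_form_nonneg:
  assumes K: "K \<subseteq> {..<N}" and B: "B \<subseteq> K"
  shows "0 \<le> (\<Sum>s\<in>outcomes N. \<Sum>t\<in>outcomes N. prob s * prob t *
    ((\<Prod>n\<in>B. (if s n = t n then 1 else 0) - 1/4) * (\<Prod>n\<in>K - B. 1/4)))"
proof -
  have finK: "finite K"
    using K finite_subset by blast
  define e :: "nat \<Rightarrow> nat \<Rightarrow> nat \<Rightarrow> real" where
    "e n i j = (if n \<in> B then (if i = j then 1 else 0) - 1/4 else 1/4)" for n i j
  have idem: "(\<Sum>k\<in>{1..4}. e n k i * e n k j) = e n i j" if "i \<in> {1..4}" "j \<in> {1..4}" for n i j
    using that unfolding sum_1_4 in_1_4 by (auto simp: e_def)
  have "(\<Prod>n\<in>B. (if s n = t n then 1 else 0) - 1/4) * (\<Prod>n\<in>K - B. 1/4)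
      = (\<Sum>u\<in>outcomes_on K. (\<Prod>n\<in>K. e n (u n) (s n)) * (\<Prod>n\<in>K. e n (u n) (t n)))"
    if "s \<in> outcomes N" "t \<in> outcomes N" for s t
  proof -
    have "(\<Sum>u\<in>outcomes_on K. (\<Prod>n\<in>K. e n (u n) (s n)) * (\<Prod>n\<in>K. e n (u n) (t n)))
        = (\<Prod>n\<in>K. \<Sum>k\<in>{1..4}. e n k (s n) * e n k (t n))"
      unfolding prod.distrib [symmetric]
      by (rule sum_outcomes_prod [OF finK, of "\<lambda>n k. e n k (s n) * e n k (t n)"])
    also have "\<dots> = (\<Prod>n\<in>K. e n (s n) (t n))"
      using that K by (intro prod.cong refl idem outcomes_range)
    also have "\<dots> = (\<Prod>n\<in>B. e n (s n) (t n)) * (\<Prod>n\<in>K - B. e n (s n) (t n))"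
      using prod.subset_diff [OF B finK, of "\<lambda>n. e n (s n) (t n)"] by (simp add: mult.commute)
    finally show ?thesis
      by (simp add: e_def)
  qed
  then have "(\<Sum>s\<in>outcomes N. \<Sum>t\<in>outcomes N. prob s * prob t *
      ((\<Prod>n\<in>B. (if s n = t n then 1 else 0) - 1/4) * (\<Prod>n\<in>K - B. 1/4)))
    = (\<Sum>u\<in>outcomes_on K. (\<Sum>s\<in>outcomes N. prob s * (\<Prod>n\<in>K. e n (u n) (s n)))\<^sup>2)"
    unfolding sum_sum_square by (intro sum.cong refl) (simp only:)
  also have "\<dots> \<ge> 0"
    by (intro sum_nonneg) auto
  finally show ?thesis .
qed

text \<open>Here \<open>a\<close> is the single-qubit eigenvalue on zero-sum vectors and
  \<open>c\<close> or \<open>d\<close> the one on constants. Expanding the tensor product over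
  subsets gives nonnegative projector forms with coefficients monotone in the latter
  eigenvalue.\<close>

lemma tensor_form_mono:
  assumes K: "K \<subseteq> {..<N}" and "0 \<le> a" "0 \<le> c" "c \<le> d"
  shows "(\<Sum>s\<in>outcomes N. \<Sum>t\<in>outcomes N. prob s * prob t * (\<Prod>n\<in>K. a * ((if s n = t n then 1 else 0) - 1/4) + c * (1/4)))
    \<le> (\<Sum>s\<in>outcomes N. \<Sum>t\<in>outcomes N. prob s * prob t * (\<Prod>n\<in>K. a * ((if s n = t n then 1 else 0) - 1/4) + d * (1/4)))"
proof -
  have finK: "finite K"
    using K finite_subset by blast
  let ?Q = "\<lambda>B s t. (\<Prod>n\<in>B. (if s n = t n then 1 else 0) - 1/4) * (\<Prod>n\<in>K - B. 1/4) :: real"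
  have expand: "(\<Sum>s\<in>outcomes N. \<Sum>t\<in>outcomes N. prob s * prob t * (\<Prod>n\<in>K. a * ((if s n = t n then 1 else 0) - 1/4) + b * (1/4)))
      = (\<Sum>B\<in>Pow K. (a ^ card B * b ^ card (K - B)) * (\<Sum>s\<in>outcomes N. \<Sum>t\<in>outcomes N. prob s * prob t * ?Q B s t))" for b
  proof -
    have "(\<Prod>n\<in>K. a * ((if s n = t n then 1 else 0) - 1/4) + b * (1/4))
        = (\<Sum>B\<in>Pow K. (a ^ card B * b ^ card (K - B)) * ?Q B s t)" for s t :: "nat \<Rightarrow> nat"
      by (subst prod_add [OF finK]) (simp only: prod.distrib prod_constant mult_ac)
    then have "(\<Sum>s\<in>outcomes N. \<Sum>t\<in>outcomes N. prob s * prob t * (\<Prod>n\<in>K. a * ((if s n = t n then 1 else 0) - 1/4) + b * (1/4)))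
      = (\<Sum>s\<in>outcomes N. \<Sum>t\<in>outcomes N. \<Sum>B\<in>Pow K. (a ^ card B * b ^ card (K - B)) * (prob s * prob t * ?Q B s t))"
      by (simp only: sum_distrib_left mult.left_commute [of "prob _ * prob _"])
    then show ?thesis
      by (simp only: sum.swap [of _ "Pow K" "outcomes N"] sum_distrib_left)
  qed
  show ?thesis
    unfolding expand using assms
    by (intro sum_mono mult_right_mono mult_left_mono power_mono projector_form_nonneg) auto
qed

text \<open>\<open>sic_kernel\<close> has eigenvalue 6 on zero-sum vectors and 2 on constants. Its
  square has 36 and 4, whereas \<open>6 * sic_kernel\<close> has 36 and 12, so raising 4 to 12
  replaces the square by a multiple of the kernel, whose mean is at most 1.\<close>

lemma kernel_projection_bound:
  assumes K: "K \<subseteq> {..<N}"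
  shows "(\<Sum>u\<in>outcomes_on K. (\<Sum>t\<in>outcomes N. prob t * shadow_kernel K u t)\<^sup>2) \<le> 6 ^ card K"
proof -
  have finK: "finite K"
    using K finite_subset by blast
  have square: "(\<Sum>k\<in>{1..4}. sic_kernel k i * sic_kernel k j) = 36 * ((if i = j then 1 else 0) - 1/4) + 4 * (1/4)"
    if "i \<in> {1..4}" "j \<in> {1..4}" for i j
    using that unfolding sum_1_4 in_1_4 by (auto simp: sic_kernel_def)
  have "(\<Sum>u\<in>outcomes_on K. shadow_kernel K u s * shadow_kernel K u t)
      = (\<Prod>n\<in>K. 36 * ((if s n = t n then 1 else 0) - 1/4) + 4 * (1/4))"
    if "s \<in> outcomes N" "t \<in> outcomes N" for s t
  proof -
    have "(\<Sum>u\<in>outcomes_on K. shadow_kernel K u s * shadow_kernel K u t)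
        = (\<Prod>n\<in>K. \<Sum>k\<in>{1..4}. sic_kernel k (s n) * sic_kernel k (t n))"
      unfolding shadow_kernel_def prod.distrib [symmetric]
      by (rule sum_outcomes_prod [OF finK, of "\<lambda>n k. sic_kernel k (s n) * sic_kernel k (t n)"])
    also have "\<dots> = (\<Prod>n\<in>K. 36 * ((if s n = t n then 1 else 0) - 1/4) + 4 * (1/4))"
      using that K by (intro prod.cong refl square outcomes_range)
    finally show ?thesis .
  qed
  then have "(\<Sum>u\<in>outcomes_on K. (\<Sum>t\<in>outcomes N. prob t * shadow_kernel K u t)\<^sup>2)
    = (\<Sum>s\<in>outcomes N. \<Sum>t\<in>outcomes N. prob s * prob t * (\<Prod>n\<in>K. 36 * ((if s n = t n then 1 else 0) - 1/4) + 4 * (1/4)))"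
    unfolding sum_sum_square by (intro sum.cong refl) (simp only:)
  also have "\<dots> \<le> (\<Sum>s\<in>outcomes N. \<Sum>t\<in>outcomes N. prob s * prob t * (\<Prod>n\<in>K. 36 * ((if s n = t n then 1 else 0) - 1/4) + 12 * (1/4)))"
    using K by (rule tensor_form_mono) auto
  also have "\<dots> = 6 ^ card K * (\<Sum>s\<in>outcomes N. \<Sum>t\<in>outcomes N. prob s * prob t * shadow_kernel K s t)"
  proof -
    have "(\<Prod>n\<in>K. 36 * ((if s n = t n then 1 else 0) - 1/4) + 12 * (1/4)) = 6 ^ card K * shadow_kernel K s t" for s t :: "nat \<Rightarrow> nat"
    proof -
      have "(\<Prod>n\<in>K. 36 * ((if s n = t n then 1 else 0) - 1/4) + 12 * (1/4)) = (\<Prod>n\<in>K. 6 * sic_kernel (s n) (t n))"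
        by (intro prod.cong) (auto simp: sic_kernel_def)
      then show ?thesis
        by (simp add: prod.distrib shadow_kernel_def)
    qed
    then show ?thesis
      by (simp add: sum_distrib_left mult_ac)
  qed
  also have "\<dots> \<le> 6 ^ card K * 1"
    using K by (intro mult_left_mono kernel_mean_le_1) auto
  finally show ?thesis
    by simp
qed

text \<open>The projection depends on \<open>s\<close> only through its restriction to
  \<open>K\<close>. Grouping by that restriction, the bound \<open>(1/2) ^ card K\<close> on each
  marginal probability meets the total \<open>6 ^ card K\<close>.\<close>

lemma kernel_projection_second_moment:
  assumes K: "K \<subseteq> {..<N}"
  shows "(\<Sum>s\<in>outcomes N. prob s * (\<Sum>t\<in>outcomes N. prob t * shadow_kernel K s t)\<^sup>2) \<le> 3 ^ card K"
proof -
  have finK: "finite K"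
    using K finite_subset by blast
  define h where "h s = (\<Sum>t\<in>outcomes N. prob t * shadow_kernel K s t)" for s
  have marginalise: "(h s)\<^sup>2 = (\<Sum>u\<in>outcomes_on K. (if \<forall>n\<in>K. s n = u n then 1 else 0) * (h u)\<^sup>2)"
    if s: "s \<in> outcomes N" for s
  proof -
    define r where "r n = (if n \<in> K then s n else 0)" for n
    have r: "r \<in> outcomes_on K" "h s = h r"
      using outcomes_range [OF s K] by (auto simp: r_def outcomes_on_def h_def shadow_kernel_def)
    have "(\<forall>n\<in>K. s n = u n) \<longleftrightarrow> u = r" if "u \<in> outcomes_on K" for u
      using that by (auto simp: outcomes_on_def r_def fun_eq_iff)
    then have "(\<Sum>u\<in>outcomes_on K. (if \<forall>n\<in>K. s n = u n then 1 else 0) * (h u)\<^sup>2)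
      = (\<Sum>u\<in>outcomes_on K. if u = r then (h u)\<^sup>2 else 0)"
      by (intro sum.cong) auto
    then show ?thesis
      using r finite_outcomes_on [OF finK] by simp
  qed
  have "(\<Sum>s\<in>outcomes N. prob s * (h s)\<^sup>2)
      = (\<Sum>s\<in>outcomes N. \<Sum>u\<in>outcomes_on K. (prob s * (if \<forall>n\<in>K. s n = u n then 1 else 0)) * (h u)\<^sup>2)"
    by (intro sum.cong refl) (simp only: marginalise sum_distrib_left mult.assoc)
  also have "\<dots> = (\<Sum>u\<in>outcomes_on K. (\<Sum>s\<in>outcomes N. prob s * (if \<forall>n\<in>K. s n = u n then 1 else 0)) * (h u)\<^sup>2)"
    by (subst sum.swap) (simp only: sum_distrib_right)
  also have "\<dots> \<le> (\<Sum>u\<in>outcomes_on K. (1/2) ^ card K * (h u)\<^sup>2)"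
    by (intro sum_mono mult_right_mono marginal_bound [OF K]) auto
  also have "\<dots> \<le> (1/2) ^ card K * 6 ^ card K"
    using kernel_projection_bound [OF K]
    by (simp add: h_def mult_left_mono flip: sum_distrib_left)
  also have "\<dots> = 3 ^ card K"
    by (simp flip: power_mult_distrib)
  finally show ?thesis
    by (simp add: h_def)
qed

section \<open>The purity estimator as a U-statistic\<close>

lemma symmetric_kernel_shadow: "symmetric_kernel (outcomes N) prob (shadow_kernel K)"
proof
  show "finite (outcomes N)"
    by (simp add: outcomes_eq finite_outcomes_on)
  show "shadow_kernel K s t = shadow_kernel K t s" for s t
    unfolding shadow_kernel_def by (intro prod.cong) (auto simp: sic_kernel_def)
qed (simp_all add: prob_nonneg sum_prob)

lemma purity_estimate_error:
  assumes K: "K \<subseteq> {..<N}" and S: "S \<in> {..<M} \<rightarrow>\<^sub>E outcomes N"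
  shows "cmod (purity_estimate N K (\<lambda>m. sic_shadow \<psi> N (S m)) M - tr_prod K (ptrace N K \<rho>) (ptrace N K \<rho>))
    = \<bar>symmetric_kernel.ustat (shadow_kernel K) M S - symmetric_kernel.mean (outcomes N) prob (shadow_kernel K)\<bar>"
proof -
  interpret symmetric_kernel "outcomes N" prob "shadow_kernel K"
    by (rule symmetric_kernel_shadow)
  have "S m \<in> outcomes N" if "m < M" for m
    using S that by auto
  then have "purity_estimate N K (\<lambda>m. sic_shadow \<psi> N (S m)) M = of_real (ustat M S)"
    using tr_prod_shadows [OF sic K] by (simp add: purity_estimate_def ustat_def)
  moreover have "tr_prod K (ptrace N K \<rho>) (ptrace N K \<rho>) = of_real mean"
    unfolding mean_def by (rule kernel_mean [OF K, symmetric])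
  ultimately show ?thesis
    by (simp flip: of_real_diff)
qed

lemma purity_estimate_variance:
  assumes K: "K \<subseteq> {..<N}" and "2 \<le> M"
  shows "finite_distribution.expect (outcomes N) prob M
      (\<lambda>S. (symmetric_kernel.ustat (shadow_kernel K) M S - symmetric_kernel.mean (outcomes N) prob (shadow_kernel K))\<^sup>2)
    \<le> 4 / real M * 3 ^ card K + 2 / (real M * (real M - 1)) * 9 ^ card K"
proof -
  interpret symmetric_kernel "outcomes N" prob "shadow_kernel K"
    by (rule symmetric_kernel_shadow)
  have "(\<Sum>a\<in>outcomes N. prob a * (proj a)\<^sup>2) \<le> 3 ^ card K"
    unfolding proj_def by (rule kernel_projection_second_moment [OF K])
  then show ?thesis
    using kernel_second_moment [OF K] assms(2)
    by (intro order_trans [OF expect_square_ustat] add_mono mult_left_mono) auto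
qed

end

section \<open>Sample size and conclusion\<close>

lemma sample_complexity_bound:
  fixes M c C e L :: real
  assumes "6 * L * C \<le> M * e" "1 \<le> c" "c \<le> C" "0 < e" "e < 1" "1 \<le> L"
  shows "4 / M * c + 2 / (M * (M - 1)) * c\<^sup>2 \<le> e / L"
proof -
  have C: "0 < C"
    using assms by linarith
  have "6 * 1 * C \<le> 6 * L * C"
    using assms C by (intro mult_right_mono) auto
  moreover have "0 < M"
  proof -
    have "0 < 6 * L * C"
      using assms C by simp
    then have "0 < M * e"
      using assms(1) by linarith
    then show ?thesis
      using assms(4) by (simp add: zero_less_mult_iff)
  qed
  moreover have "M * e \<le> M"
    using assms \<open>0 < M\<close> by simp
  ultimately have "6 * C \<le> M"
    using assms(1) by linarith
  note M = this \<open>0 < M\<close>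
  have first: "c / M \<le> e / L / 6"
  proof -
    have "6 * L * c \<le> 6 * L * C"
      using assms by (intro mult_left_mono) auto
    then have "6 * L * c \<le> M * e"
      using assms(1) by linarith
    then show ?thesis
      using M assms by (simp add: field_simps)
  qed
  \<comment> \<open>From \<open>6 * C \<le> M\<close> and \<open>1 \<le> c \<le> C\<close> it
    follows that \<open>M - 1\<close> is at least \<open>5 * c\<close>.\<close>
  have "c / (M - 1) \<le> 1 / 5"
    using M assms by (simp add: field_simps)
  then have second: "c / M * (c / (M - 1)) \<le> c / M * (1 / 5)"
    using M assms by (intro mult_left_mono) auto
  have "4 / M * c + 2 / (M * (M - 1)) * c\<^sup>2 = 4 * (c / M) + 2 * (c / M * (c / (M - 1)))"
    by (simp add: power2_eq_square)
  also have "\<dots> \<le> 4 * (c / M) + 2 * (c / M * (1 / 5))"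
    using second by simp
  also have "\<dots> = 22 / 5 * (c / M)"
    by simp
  also have "\<dots> \<le> 22 / 5 * (e / L / 6)"
    using first by (intro mult_left_mono) auto
  \<comment> \<open>The constant 6 in the sample size suffices because 22/30 is below 1.\<close>
  also have "\<dots> \<le> e / L"
    using assms by (simp add: field_simps)
  finally show ?thesis .
qed

theorem mainTheorem6:
  fixes \<psi> :: "nat \<Rightarrow> bool \<Rightarrow> complex" and \<rho> :: qop and N L M :: nat
    and Ks :: "nat \<Rightarrow> nat set" and \<epsilon> \<delta> :: real
  assumes "SIC_set \<psi>"
    and "density_matrix N \<rho>"
    and "0 < L" and "\<forall>l<L. Ks l \<subseteq> {..<N}"
    and "0 < \<epsilon>" and "\<epsilon> < 1" and "0 < \<delta>" and "\<delta> < 1"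
    and "real M \<ge> 6 * real L * 3 ^ (Max (card ` Ks ` {..<L})) / (\<epsilon>\<^sup>2 * \<delta>)"
  shows "1 - \<delta> \<le>
    (\<Sum>S\<in>{S\<in>PiE {..<M} (\<lambda>_. outcomes N).
           Max ((\<lambda>l. cmod (purity_estimate N (Ks l) (\<lambda>m. sic_shadow \<psi> N (S m)) M
                   - tr_prod (Ks l) (ptrace N (Ks l) \<rho>) (ptrace N (Ks l) \<rho>))) ` {..<L}) \<le> \<epsilon>}.
       \<Prod>m<M. outcome_prob \<psi> N \<rho> (S m))"
proof -
  interpret sic_measurement \<psi> N \<rho>
    by unfold_locales (rule assms)+
  \<comment> \<open>Only the outcome distribution matters for \<open>expect\<close> and
    \<open>chebyshev_union\<close>; the kernel of the empty subsystem is a placeholder, so that one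
    expectation serves all \<open>l\<close>.\<close>
  interpret outcome: symmetric_kernel "outcomes N" prob "shadow_kernel {}"
    by (rule symmetric_kernel_shadow)
  let ?e = "\<epsilon>\<^sup>2 * \<delta>"
  let ?k = "Max (card ` Ks ` {..<L})"
  let ?Z = "\<lambda>l S. symmetric_kernel.ustat (shadow_kernel (Ks l)) M S
      - symmetric_kernel.mean (outcomes N) prob (shadow_kernel (Ks l))"
  have "\<epsilon>\<^sup>2 * \<delta> \<le> 1 * \<delta>"
    using assms(5-8) by (intro mult_right_mono power_le_one) auto
  moreover have "0 < ?e"
    using assms(5,7) by simp
  ultimately have e: "0 < ?e \<and> ?e < 1"
    using assms(8) by linarith
  have M: "6 * real L * 3 ^ ?k \<le> real M * ?e"
    using assms(9) e by (simp add: pos_divide_le_eq)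
  have "2 \<le> M"
  proof -
    have "6 * 1 * 1 \<le> 6 * real L * 3 ^ ?k"
      using assms(3) by (intro mult_mono) auto
    also note M
    also have "real M * ?e \<le> real M * 1"
      using e by (intro mult_left_mono) auto
    finally show ?thesis
      by simp
  qed
  have "outcome.expect M (\<lambda>S. (?Z l S)\<^sup>2) \<le> ?e / real L" if "l \<in> {..<L}" for l
  proof -
    have "outcome.expect M (\<lambda>S. (?Z l S)\<^sup>2)
        \<le> 4 / real M * 3 ^ card (Ks l) + 2 / (real M * (real M - 1)) * 9 ^ card (Ks l)"
      using assms(4) that \<open>2 \<le> M\<close> by (intro purity_estimate_variance) auto
    also have "(9::real) ^ card (Ks l) = (3 ^ card (Ks l))\<^sup>2"
      by (simp add: power2_eq_square flip: power_mult_distrib)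
    also have "4 / real M * 3 ^ card (Ks l) + 2 / (real M * (real M - 1)) * (3 ^ card (Ks l))\<^sup>2 \<le> ?e / real L"
    \<comment> \<open>Here \<open>c\<close> is \<open>3 ^ card (Ks l)\<close>, \<open>C\<close> is
      \<open>3 ^ ?k\<close> and \<open>e\<close> is \<open>?e\<close>.\<close>
    proof (rule sample_complexity_bound [OF M])
      show "(3::real) ^ card (Ks l) \<le> 3 ^ ?k"
        using that by (intro power_increasing Max_ge) auto
    qed (use e assms(3) in auto)
    finally show ?thesis .
  qed
  \<comment> \<open>The \<open>L\<close> events together fail with probability at most
    \<open>L * (?e / L) / \<epsilon>\<^sup>2\<close>, which is \<open>\<delta>\<close>.\<close>
  then have "1 - real (card {..<L}) * (?e / real L) / \<epsilon>\<^sup>2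
    \<le> (\<Sum>S\<in>{S \<in> {..<M} \<rightarrow>\<^sub>E outcomes N. \<forall>l\<in>{..<L}. \<bar>?Z l S\<bar> \<le> \<epsilon>}. \<Prod>m<M. prob (S m))"
    by (intro outcome.chebyshev_union finite_lessThan assms(5))
  \<comment> \<open>As \<open>L\<close> is positive the maximum ranges over a nonempty set, so
    bounding it amounts to bounding every error.\<close>
  also have "{S \<in> {..<M} \<rightarrow>\<^sub>E outcomes N. \<forall>l\<in>{..<L}. \<bar>?Z l S\<bar> \<le> \<epsilon>}
    = {S \<in> {..<M} \<rightarrow>\<^sub>E outcomes N. Max ((\<lambda>l. cmod (purity_estimate N (Ks l) (\<lambda>m. sic_shadow \<psi> N (S m)) M
                   - tr_prod (Ks l) (ptrace N (Ks l) \<rho>) (ptrace N (Ks l) \<rho>))) ` {..<L}) \<le> \<epsilon>}"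
    using assms(3,4) by (intro Collect_cong conj_cong refl) (simp add: purity_estimate_error Max_le_iff lessThan_empty_iff)
  finally show ?thesis
    using assms(3,5) by simp
qed

end
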